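(* Let $X$ be a simplicial complex on $[n]$ with Stanley-Reisner ring $A_X$. For $i=1,2$ let $\mathbf a^i\in\mathbb N^{n+1}$ and $\mathbf b^i\in\{0,1\}^{n+1}$ have disjoint supports $a^i$ and $b^i$. Write $(\mathbf a^1-\mathbf b^1)+(\mathbf a^2-\mathbf b^2)=\mathbf a-\mathbf b$ with $\mathbf a,\mathbf b\in\mathbb N^{n+1}$ having disjoint supports $a,b$. The cup product $\cup:T^1_{\mathbf a^1-\mathbf b^1}(X)\times T^1_{\mathbf a^2-\mathbf b^2}(X)\to T^2_{\mathbf a-\mathbf b}(X)$ is determined by the following. (i) If $b^1\cap b^2\neq\emptyset$, then $\cup=0$. (ii) If $b^1\cap b^2=\emptyset$, then $b=(b^1\setminus a^2)\cup(b^2\setminus a^1)$ and $a=(a^1\setminus b^2)\cup(a^2\setminus b^1)\cup(a^1_{\ge2}\cup a^2_{\ge2})$, where $a^{j}_{\geq2}:=\{v\in[n] : \mathbf a^{j}_v\ge2\}$. (iii) (In the situation $b^1\cap b^2=\emptyset$.) For each $f\in N_{a-b}$ choose a maximal subset $d_f\subseteq b$ such that $f\cup(b\setminus d_f)\notin X$. Let $\varphi\in T^1_{\mathbf a^1-\mathbf b^1}(X)$ and $\psi\in T^1_{\mathbf a^2-\mathbf b^2}(X)$ be represented by functions $\varphi:N_{a^1-b^1}\to\mathbb C$ and $\psi:N_{a^2-b^2}\to\mathbb C$, extended by zero to the other subsets of $[n]$. Then $\varphi\cup\psi$ is represented by the function on $N^{(2)}_{a-b}$ whose value at $(f,g)\in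 N_{a-b}^{(2)}$ is, with $d=d_f$ and $e=d_g$, $$\begin{aligned}(\varphi\cup\psi)(f,g)=\;&\Big[\varphi\big((f\setminus b^1)\cup(b^2\setminus d)\big)-\varphi\big((g\setminus b^1)\cup(b^2\setminus e)\big)\Big]\cdot\psi\big((f\cup g\cup a^2)\setminus b^2\big)\\&+\Big[\psi\big((f\setminus b^2)\cup(b^1\setminus d)\big)-\psi\big((g\setminus b^2)\cup(b^1\setminus e)\big)\Big]\cdot\varphi\big((f\cup g\cup a^1)\setminus b^1\big).\end{aligned}$$
   Context: Let $[n]=\{0,\dots,n\}$ and $P=\mathbb C[x_0,\dots,x_n]$. A simplicial complex $X$ on $[n]$ is a family of subsets of $[n]$ closed under taking subsets, with $\emptyset\in X$. A subset $p\subseteq[n]$ is identified with its characteristic vector in $\{0,1\}^{n+1}$; the support of $\mathbf p\in\mathbb N^{n+1}$ is $p=\{i:\mathbf p_i\neq0\}$. Put $I_X=\langle \mathbf x^p : p\notin X\rangle$, $A_X=P/I_X$. For $A=P/I$: $T^1_A$ is the cokernel of $\mathrm{Der}_{\mathbb C}(P,P)\to\mathrm{Hom}_P(I,A)$. If $0\to R\to P^m\xrightarrow{j}P\to A\to0$ is exact and $R_0=\langle j(f)e-j(e)f\rangle\subseteq R$, then $T^2_A$ is the cokernel of $\mathrm{Hom}_P(P^m,A)\to\mathrm{Hom}_A(R/R_0,A)$. For $A=A_X$ these are $\mathbb Z^{n+1}$-graded and $T^i_{\mathbf c}(X)$ is the degree $\mathbf c$ part of $T^i_{A_X}$. Take as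 generators of $I_X$ all $\mathbf x^p$, $p\notin X$, with basis $e_p$ of the free module; $R$ is generated by $R_{p,q}=\mathbf x^{q\setminus p}e_p-\mathbf x^{p\setminus q}e_q$. Cup product: let $I$ be generated by $f^p$. For $\varphi\in\mathrm{Hom}(I,A)$ choose lifts $\widetilde\varphi(f^p)\in P$ of $\varphi(f^p)$; for a relation $r=\sum_p r_pe_p\in R$ the element $\langle r,\widetilde\varphi\rangle:=\sum_pr_p\widetilde\varphi(f^p)$ lies in $I$. For $\varphi,\psi\in\mathrm{Hom}(I,A)$ put $(\varphi\cup\psi)(r):=\psi(\langle r,\widetilde\varphi\rangle)+\varphi(\langle r,\widetilde\psi\rangle)$; this gives a well-defined bilinear map $T^1_A\times T^1_A\to T^2_A$, respecting the multigrading for $A=A_X$. For disjoint $a,b\subseteq[n]$: $N_{a-b}=\{f\in X : a\subseteq f,\ f\cap b=\emptyset,\ f\cup b\notin X\}$; $\widetilde N_{a-b}=\{f\in N_{a-b}: f\cup b'\notin X\text{ for some proper subset }b'\subsetneq b\}$; $N^{(2)}_{a-b}=\{(f,g)\in N_{a-b}\times N_{a-b} : f\cup g\in X\}$; $M_{a-b}=\{p\subseteq[n] : p\notin X,\ (p\cup a)\setminus b\in X\}$; $\Phi(p)=(p\cup a)\setminus b$, a surjection $M_{a-b}\to N_{a-b}$. Identifications used (for $\mathbf b=b\in\{0,1\}^{n+1}$, $\mathbf c=\mathbf a-b$): elements of $\mathrm{Hom}_P(I_X,A_X)_{\mathbf c}$ correspond to functions $\lambda:N_{a-b}\to\mathbb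 C$ with $\lambda(f)=0$ for $f\in\widetilde N_{a-b}$ and $\lambda(f)=\lambda(g)$ if $f\cup g\in X$, via $\mathbf x^p\mapsto\lambda(\Phi(p))\,\mathbf x^{p+\mathbf a-b}$ for $p\in M_{a-b}$ and $\mathbf x^p\mapsto 0$ otherwise; such functions represent classes in $T^1_{\mathbf c}(X)$. $T^2_{\mathbf c}(X)$ is the space of antisymmetric $\lambda:N^{(2)}_{a-b}\to\mathbb C$ with $\lambda(f,g)=0$ if $f,g\in\widetilde N_{a-b}$ and $\lambda(f,g)-\lambda(f,h)+\lambda(g,h)=0$ if $f\cup g\cup h\in X$, modulo the functions $\lambda(f)-\lambda(g)$ with $\lambda:N_{a-b}\to\mathbb C$ vanishing on $\widetilde N_{a-b}$; here $\lambda$ corresponds to the homomorphism $R_{p,q}\mapsto\lambda(\Phi(p),\Phi(q))\,\mathbf x^{(p\cup q)+\mathbf a-b}$ if $(p\cup q\cup a)\setminus b\in X$ and $R_{p,q}\mapsto 0$ otherwise. *)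

theory Defs
  imports
    Complex_Main
    "HOL-Library.Poly_Mapping"
    "HOL-Library.Function_Algebras"
    "HOL-Library.Set_Algebras"
    "HOL-Library.FuncSet"
    "HOL-Library.Indicator_Function"
begin

section \<open>Polynomials and Stanley-Reisner rings\<close>

text \<open>The vertex set \<open>[n]\<close> is a finite type \<open>'v\<close> (so \<open>CARD('v) = n + 1\<close>), and
  \<open>P\<close> is the whole type \<open>'v mpoly\<close>.\<close>

type_synonym 'v mpoly = "('v \<Rightarrow>\<^sub>0 nat) \<Rightarrow>\<^sub>0 complex"

text \<open>\<open>mon z d\<close> is the term \<open>z x\<^sup>d\<close>. Multidegrees are integer vectors, and \<open>x\<^sup>d\<close> is read as \<open>0\<close>
  when \<open>d\<close> has a negative entry; thus \<open>range (\<lambda>z. mon z d)\<close> is the degree \<open>d\<close> part of \<open>P\<close>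
  for every \<open>d\<close>.\<close>

definition mon :: "complex \<Rightarrow> ('v::finite \<Rightarrow> int) \<Rightarrow> 'v mpoly" where
  "mon z d = (if \<forall>v. 0 \<le> d v
     then Poly_Mapping.single (\<Sum>v\<in>UNIV. Poly_Mapping.single v (nat (d v))) z else 0)"

definition xmon :: "'v::finite set \<Rightarrow> 'v mpoly" where
  "xmon p = mon 1 (indicator p)"

definition simplicial_complex :: "'v set set \<Rightarrow> bool" where
  "simplicial_complex X \<longleftrightarrow> {} \<in> X \<and> (\<forall>f\<in>X. \<forall>g. g \<subseteq> f \<longrightarrow> g \<in> X)"

definition SR_ideal :: "'v::finite set set \<Rightarrow> 'v mpoly set" where
  "SR_ideal X = module.span (*) {xmon p | p. p \<notin> X}"

section \<open>Quotients and homomorphisms\<close>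

definition quot :: "'m::ab_group_add set \<Rightarrow> 'm set \<Rightarrow> 'm set set" where
  "quot M N = (\<lambda>x. x +o N) ` M"

definition SR_ring :: "'v::finite set set \<Rightarrow> 'v mpoly set set" where
  "SR_ring X = quot UNIV (SR_ideal X)"

text \<open>Addition in \<open>P/I\<close> is the elementwise sum of cosets. The set \<open>r *o C\<close> is in general only
  part of a coset of \<open>I\<close>, so the scalar multiple of \<open>C \<in> P/I\<close> by \<open>r\<close> is \<open>r *o C + I\<close>.\<close>

definition coset_scale :: "'r::comm_ring_1 set \<Rightarrow> 'r \<Rightarrow> 'r set \<Rightarrow> 'r set" where
  "coset_scale I r C = r *o C + I"

text \<open>\<open>Hom_P(M, P/I)\<close> for a submodule \<open>M\<close> of a \<open>P\<close>-module with scalar multiplication \<open>s\<close>.\<close>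

definition hom_quot ::
  "('r::comm_ring_1 \<Rightarrow> 'm::ab_group_add \<Rightarrow> 'm) \<Rightarrow> 'm set \<Rightarrow> 'r set \<Rightarrow> ('m \<Rightarrow> 'r set) set" where
  "hom_quot s M I = {\<phi> \<in> M \<rightarrow>\<^sub>E quot UNIV I.
     (\<forall>x\<in>M. \<forall>y\<in>M. \<phi> (x + y) = \<phi> x + \<phi> y) \<and>
     (\<forall>r. \<forall>x\<in>M. \<phi> (s r x) = coset_scale I r (\<phi> x))}"

section \<open>The module \<open>T\<^sup>1\<close>\<close>

definition derivations :: "('v mpoly \<Rightarrow> 'v mpoly) set" where
  "derivations = {D. (\<forall>f g. D (f + g) = D f + D g) \<and>
     (\<forall>z f. D (Poly_Mapping.single 0 z * f) = Poly_Mapping.single 0 z * D f) \<and>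
     (\<forall>f g. D (f * g) = f * D g + g * D f)}"

definition Hom_I :: "'v::finite set set \<Rightarrow> ('v mpoly \<Rightarrow> 'v mpoly set) set" where
  "Hom_I X = hom_quot (*) (SR_ideal X) (SR_ideal X)"

definition T1_class ::
  "'v::finite set set \<Rightarrow> ('v mpoly \<Rightarrow> 'v mpoly set) \<Rightarrow> ('v mpoly \<Rightarrow> 'v mpoly set) set" where
  "T1_class X \<phi> = {\<psi> \<in> Hom_I X. \<exists>D\<in>derivations. \<forall>f\<in>SR_ideal X. \<psi> f = \<phi> f + (D f +o SR_ideal X)}"

definition SR_degree :: "'v::finite set set \<Rightarrow> ('v \<Rightarrow> int) \<Rightarrow> 'v mpoly set set" where
  "SR_degree X d = range (\<lambda>z. mon z d +o SR_ideal X)"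

definition Hom_I_degree :: "'v::finite set set \<Rightarrow> ('v \<Rightarrow> int) \<Rightarrow> ('v mpoly \<Rightarrow> 'v mpoly set) set" where
  "Hom_I_degree X c = {\<phi> \<in> Hom_I X.
     \<forall>d. \<forall>f\<in>SR_ideal X. f \<in> range (\<lambda>z. mon z d) \<longrightarrow> \<phi> f \<in> SR_degree X (d + c)}"

definition T1 :: "'v::finite set set \<Rightarrow> ('v \<Rightarrow> int) \<Rightarrow> ('v mpoly \<Rightarrow> 'v mpoly set) set set" where
  "T1 X c = T1_class X ` Hom_I_degree X c"

section \<open>The module \<open>T\<^sup>2\<close>\<close>

text \<open>The free module on the basis \<open>e\<^sub>p\<close>, \<open>p \<notin> X\<close>.\<close>

type_synonym 'v pvec = "'v set \<Rightarrow> 'v mpoly"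

definition vscale :: "'v mpoly \<Rightarrow> 'v pvec \<Rightarrow> 'v pvec" where
  "vscale f r = (\<lambda>p. f * r p)"

definition free_mod :: "'v set set \<Rightarrow> 'v pvec set" where
  "free_mod X = {r. \<forall>p\<in>X. r p = 0}"

definition basis_vec :: "'v set \<Rightarrow> 'v pvec" where
  "basis_vec p = (\<lambda>q. if q = p then 1 else 0)"

text \<open>\<open>pairing X r u\<close> is \<open>\<langle>r, u\<rangle> = \<Sum>\<^sub>p r\<^sub>p u\<^sub>p\<close>.\<close>

definition pairing :: "'v::finite set set \<Rightarrow> 'v pvec \<Rightarrow> 'v pvec \<Rightarrow> 'v mpoly" where
  "pairing X r u = (\<Sum>p | p \<notin> X. r p * u p)"

definition gen_map :: "'v::finite set set \<Rightarrow> 'v pvec \<Rightarrow> 'v mpoly" where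
  "gen_map X r = pairing X r xmon"

definition Rel :: "'v::finite set set \<Rightarrow> 'v pvec set" where
  "Rel X = {r \<in> free_mod X. gen_map X r = 0}"

definition Rel0 :: "'v::finite set set \<Rightarrow> 'v pvec set" where
  "Rel0 X = module.span vscale
     {vscale (gen_map X f) e - vscale (gen_map X e) f | e f. e \<in> free_mod X \<and> f \<in> free_mod X}"

definition Rel_gen :: "'v::finite set \<Rightarrow> 'v set \<Rightarrow> 'v pvec" where
  "Rel_gen p q = vscale (xmon (q - p)) (basis_vec p) - vscale (xmon (p - q)) (basis_vec q)"

text \<open>\<open>Hom\<^sub>A(R/R\<^sub>0, A)\<close>. The action of \<open>A = P/I\<close> on \<open>R/R\<^sub>0\<close> and on \<open>A\<close> is induced by that of \<open>P\<close>,
  so \<open>A\<close>-linearity of \<open>h\<close> is \<open>P\<close>-linearity of its composite with \<open>R \<rightarrow> R/R\<^sub>0\<close>.\<close>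

definition Hom_Rel :: "'v::finite set set \<Rightarrow> ('v pvec set \<Rightarrow> 'v mpoly set) set" where
  "Hom_Rel X = {h \<in> quot (Rel X) (Rel0 X) \<rightarrow>\<^sub>E SR_ring X.
     (\<lambda>r\<in>Rel X. h (r +o Rel0 X)) \<in> hom_quot vscale (Rel X) (SR_ideal X)}"

definition T2_class ::
  "'v::finite set set \<Rightarrow> ('v pvec set \<Rightarrow> 'v mpoly set) \<Rightarrow> ('v pvec set \<Rightarrow> 'v mpoly set) set" where
  "T2_class X h = {h' \<in> Hom_Rel X. \<exists>k\<in>hom_quot vscale (free_mod X) (SR_ideal X).
     \<forall>r\<in>Rel X. h' (r +o Rel0 X) = h (r +o Rel0 X) + k r}"

text \<open>The basis vector \<open>e\<^sub>p\<close> has degree \<open>p\<close>.\<close>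

definition Hom_Rel_degree ::
  "'v::finite set set \<Rightarrow> ('v \<Rightarrow> int) \<Rightarrow> ('v pvec set \<Rightarrow> 'v mpoly set) set" where
  "Hom_Rel_degree X c = {h \<in> Hom_Rel X.
     \<forall>d. \<forall>r\<in>Rel X. (\<forall>p. r p \<in> range (\<lambda>z. mon z (d - indicator p))) \<longrightarrow>
       h (r +o Rel0 X) \<in> SR_degree X (d + c)}"

definition T2 :: "'v::finite set set \<Rightarrow> ('v \<Rightarrow> int) \<Rightarrow> ('v pvec set \<Rightarrow> 'v mpoly set) set set" where
  "T2 X c = T2_class X ` Hom_Rel_degree X c"

definition T2_zero :: "'v::finite set set \<Rightarrow> ('v pvec set \<Rightarrow> 'v mpoly set) set" where
  "T2_zero X = T2_class X (\<lambda>_\<in>quot (Rel X) (Rel0 X). SR_ideal X)"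

section \<open>The cup product\<close>

definition lifts :: "'v::finite set set \<Rightarrow> ('v mpoly \<Rightarrow> 'v mpoly set) \<Rightarrow> 'v pvec set" where
  "lifts X \<phi> = {u. \<forall>p. p \<notin> X \<longrightarrow> u p \<in> \<phi> (xmon p)}"

text \<open>The union of the classes obtained from all choices of representatives and of lifts. It is
  an element of \<open>T\<^sup>2\<close> precisely because the class does not depend on these choices.\<close>

definition cup ::
  "'v::finite set set \<Rightarrow> ('v mpoly \<Rightarrow> 'v mpoly set) set \<Rightarrow> ('v mpoly \<Rightarrow> 'v mpoly set) set
    \<Rightarrow> ('v pvec set \<Rightarrow> 'v mpoly set) set" where
  "cup X \<xi> \<eta> = \<Union> {T2_class X h | h. h \<in> Hom_Rel X \<and>
     (\<exists>\<phi>\<in>\<xi>. \<exists>\<psi>\<in>\<eta>. \<exists>u\<in>lifts X \<phi>. \<exists>w\<in>lifts X \<psi>.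
        \<forall>r\<in>Rel X. h (r +o Rel0 X) = \<psi> (pairing X r u) + \<phi> (pairing X r w))}"

section \<open>Combinatorial description\<close>

definition N :: "'v set set \<Rightarrow> 'v set \<Rightarrow> 'v set \<Rightarrow> 'v set set" where
  "N X a b = {f \<in> X. a \<subseteq> f \<and> f \<inter> b = {} \<and> f \<union> b \<notin> X}"

definition N_tilde :: "'v set set \<Rightarrow> 'v set \<Rightarrow> 'v set \<Rightarrow> 'v set set" where
  "N_tilde X a b = {f \<in> N X a b. \<exists>b'. b' \<subset> b \<and> f \<union> b' \<notin> X}"

definition N2 :: "'v set set \<Rightarrow> 'v set \<Rightarrow> 'v set \<Rightarrow> ('v set \<times> 'v set) set" where
  "N2 X a b = {(f, g). f \<in> N X a b \<and> g \<in> N X a b \<and> f \<union> g \<in> X}"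

definition M :: "'v set set \<Rightarrow> 'v set \<Rightarrow> 'v set \<Rightarrow> 'v set set" where
  "M X a b = {p. p \<notin> X \<and> (p \<union> a) - b \<in> X}"

definition Phi :: "'v set \<Rightarrow> 'v set \<Rightarrow> 'v set \<Rightarrow> 'v set" where
  "Phi a b p = (p \<union> a) - b"

definition supp :: "('v \<Rightarrow> nat) \<Rightarrow> 'v set" where
  "supp a = {v. a v \<noteq> 0}"

definition deg :: "('v \<Rightarrow> nat) \<Rightarrow> ('v \<Rightarrow> nat) \<Rightarrow> 'v \<Rightarrow> int" where
  "deg a b = (\<lambda>v. int (a v) - int (b v))"

definition T1_funs :: "'v set set \<Rightarrow> 'v set \<Rightarrow> 'v set \<Rightarrow> ('v set \<Rightarrow> complex) set" where
  "T1_funs X a b = {l. (\<forall>f\<in>N_tilde X a b. l f = 0) \<and>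
     (\<forall>f\<in>N X a b. \<forall>g\<in>N X a b. f \<union> g \<in> X \<longrightarrow> l f = l g)}"

text \<open>If \<open>b\<close> is a 0/1-vector and some exponent in \<open>p + a - b\<close> below is negative, then
  \<open>b\<close> is not contained in \<open>p\<close>, hence \<open>Phi p\<close> lies in \<open>N_tilde\<close> and the coefficient vanishes;
  similarly for \<open>represents2\<close>. So the convention for negative exponents in \<open>mon\<close> is harmless.\<close>

definition represents1 ::
  "'v::finite set set \<Rightarrow> ('v \<Rightarrow> nat) \<Rightarrow> ('v \<Rightarrow> nat) \<Rightarrow> ('v set \<Rightarrow> complex)
    \<Rightarrow> ('v mpoly \<Rightarrow> 'v mpoly set) set \<Rightarrow> bool" where
  "represents1 X a b l \<xi> \<longleftrightarrow> l \<in> T1_funs X (supp a) (supp b) \<and>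
     (\<exists>\<phi>\<in>\<xi>. \<forall>p. p \<notin> X \<longrightarrow>
        \<phi> (xmon p) = (if p \<in> M X (supp a) (supp b)
          then mon (l (Phi (supp a) (supp b) p)) (indicator p + deg a b) else 0) +o SR_ideal X)"

definition T2_funs :: "'v set set \<Rightarrow> 'v set \<Rightarrow> 'v set \<Rightarrow> ('v set \<Rightarrow> 'v set \<Rightarrow> complex) set" where
  "T2_funs X a b = {l.
     (\<forall>(f, g)\<in>N2 X a b. l f g = - l g f) \<and>
     (\<forall>(f, g)\<in>N2 X a b. f \<in> N_tilde X a b \<longrightarrow> g \<in> N_tilde X a b \<longrightarrow> l f g = 0) \<and>
     (\<forall>f\<in>N X a b. \<forall>g\<in>N X a b. \<forall>h\<in>N X a b. f \<union> g \<union> h \<in> X \<longrightarrow> l f g - l f h + l g h = 0)}"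

definition represents2 ::
  "'v::finite set set \<Rightarrow> ('v \<Rightarrow> nat) \<Rightarrow> ('v \<Rightarrow> nat) \<Rightarrow> ('v set \<Rightarrow> 'v set \<Rightarrow> complex)
    \<Rightarrow> ('v pvec set \<Rightarrow> 'v mpoly set) set \<Rightarrow> bool" where
  "represents2 X a b l \<zeta> \<longleftrightarrow> l \<in> T2_funs X (supp a) (supp b) \<and>
     (\<exists>h\<in>\<zeta>. \<forall>p q. p \<notin> X \<and> q \<notin> X \<longrightarrow>
        h (Rel_gen p q +o Rel0 X) = (if (p \<union> q \<union> supp a) - supp b \<in> X
          then mon (l (Phi (supp a) (supp b) p) (Phi (supp a) (supp b) q))
                 (indicator (p \<union> q) + deg a b) else 0) +o SR_ideal X)"

definition maximal_removable :: "'v set set \<Rightarrow> 'v set \<Rightarrow> 'v set \<Rightarrow> 'v set \<Rightarrow> bool" where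
  "maximal_removable X b f d \<longleftrightarrow> d \<subseteq> b \<and> f \<union> (b - d) \<notin> X \<and>
     (\<forall>d'. d \<subset> d' \<and> d' \<subseteq> b \<longrightarrow> f \<union> (b - d') \<in> X)"

end

theory Submission
  imports Defs
begin

text \<open>Write \<open>I\<close> for the Stanley-Reisner ideal and \<open>\<langle>r, u\<rangle>\<close> for the pairing of a relation with a vector of
  values on the generators. The cup product sends a relation \<open>r\<close> to
  \<open>\<psi> \<langle>r, u\<rangle> + \<phi> \<langle>r, w\<rangle>\<close>, where \<open>u\<close> and \<open>w\<close> lift the values of \<open>\<phi>\<close> and \<open>\<psi>\<close>. Its class does not
  depend on the choices, because replacing \<open>\<phi>\<close> by \<open>\<phi> + D\<close> for a derivation \<open>D\<close>, or changing a lift,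
  adds the restriction of a homomorphism defined on the whole free module
  (\<open>cup_rep_change_left\<close>, \<open>cup_eq_T2_class\<close>). Hence it may be computed with the most convenient
  representatives and lifts. Homogeneous ones show that it is homogeneous of the sum of the degrees.

  If \<open>b1\<close> and \<open>b2\<close> share a vertex \<open>v\<close>, this degree is \<open>-2\<close> at \<open>v\<close>. The module \<open>R\<close> is generated by the
  relations \<open>R\<^sub>p\<^sub>,\<^sub>q\<close> (\<open>Rel_generated\<close>), whose degrees \<open>p \<union> q\<close> have no exponent above one, so every
  homomorphism of such a degree vanishes (\<open>Hom_Rel_degree_trivial\<close>).

  Suppose now that \<open>b1\<close> and \<open>b2\<close> are disjoint. Write \<open>\<Phi>, \<Phi>1, \<Phi>2\<close> for the maps \<open>p \<mapsto> (p \<union> a) - b\<close>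
  belonging to the three degrees and put
  \<open>S\<^sub>F(p) = \<phi>(\<Phi>1 p) \<psi>(\<Phi>2 F) + \<psi>(\<Phi>2 p) \<phi>(\<Phi>1 F)\<close>. With monomial lifts the cup product takes \<open>R\<^sub>p\<^sub>,\<^sub>q\<close>
  to \<open>S\<^sub>F(p) - S\<^sub>F(q)\<close> times the monomial of the right degree, for \<open>F = \<Phi>(p \<union> q)\<close>
  (\<open>cup_rep_Rel_gen\<close>). This coefficient depends on \<open>p\<close> and \<open>q\<close>, not only on \<open>f = \<Phi> p\<close> and \<open>g = \<Phi> q\<close>.
  The stated formula is \<open>S\<^sub>F(p\<^sub>f) - S\<^sub>F(p\<^sub>g)\<close> for the particular nonfaces
  \<open>p\<^sub>f = f \<union> (b - d\<^sub>f)\<close> with \<open>\<Phi> p\<^sub>f = f\<close>. So the coefficients \<open>S\<^sub>f(p) - S\<^sub>f(p\<^sub>f)\<close> have to be those of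
  a homomorphism on the free module that accounts for the difference. Two facts make this work:

  \<^item> If \<open>b\<close> is not contained in \<open>p\<close>, then \<open>S\<^sub>F(p) = \<phi>(\<Phi>1 F) \<psi>(\<Phi>2 F)\<close>, independently of \<open>p\<close>
    (\<open>cup_coeff_not_subset\<close>). So the correction vanishes where the monomial of its degree
    has a negative exponent and a homomorphism must vanish. It is here that maximality of \<open>d\<^sub>f\<close>
    enters: it ensures that \<open>p\<^sub>f\<close> does not contain \<open>b\<close> unless \<open>f\<close> lies outside \<open>N_tilde X a b\<close>.

  \<^item> The difference \<open>S\<^sub>F(p) - S\<^sub>F(q)\<close> does not change when the face \<open>F\<close> is enlarged
    (\<open>cup_coeff_diff\<close>). So the correction depends on \<open>p\<close> alone, and the formula satisfies the
    cocycle condition.\<close>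
section \<open>Cosets and linear maps into a quotient ring\<close>

context module
begin

lemma coset_eq_iff:
  assumes "subspace S"
  shows "x +o S = y +o S \<longleftrightarrow> x - y \<in> S"
proof
  assume "x +o S = y +o S"
  moreover have "x \<in> x +o S"
    using subspace_0[OF assms] by (force simp: elt_set_plus_def)
  ultimately show "x - y \<in> S"
    by (metis set_minus_plus)
next
  assume xy: "x - y \<in> S"
  have "z - x \<in> S \<longleftrightarrow> z - y \<in> S" for z
    using subspace_add[OF assms _ xy, of "z - x"] subspace_diff[OF assms _ xy, of "z - y"]
    by (auto simp: algebra_simps)
  then show "x +o S = y +o S"
    by (auto simp: set_eq_iff simp flip: set_minus_plus)
qed

lemma subspace_add_self:
  assumes "subspace S"
  shows "S + S = S"
proof
  show "S + S \<subseteq> S"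
    using subspace_add[OF assms] by (auto elim!: set_plus_elim)
  show "S \<subseteq> S + S"
    using subspace_0[OF assms] by (rule set_zero_plus2)
qed

lemma coset_add:
  assumes "subspace S"
  shows "(x +o S) + (y +o S) = (x + y) +o S"
  by (simp add: set_plus_rearrange subspace_add_self[OF assms])

lemma coset_zero_iff:
  assumes "subspace S"
  shows "x +o S = S \<longleftrightarrow> x \<in> S"
  using coset_eq_iff[OF assms, of x 0] by simp

lemma mem_coset_self: "subspace S \<Longrightarrow> x \<in> x +o S"
  using subspace_0[of S] by (force simp: elt_set_plus_def)

end

interpretation ideal: module "(*) :: 'r::comm_ring_1 \<Rightarrow> 'r \<Rightarrow> 'r"
  by unfold_locales (auto simp: algebra_simps)

(* As a rewrite rule it loops together with mult.assoc. *)
declare ideal.scale_scale [simp del]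

lemma module_vscale: "module (vscale :: 'v mpoly \<Rightarrow> 'v pvec \<Rightarrow> 'v pvec)"
proof (rule module.intro)
  show "vscale a (x + y) = vscale a x + vscale a y" for a and x y :: "'v pvec"
    by (rule ext) (simp add: vscale_def distrib_left)
  show "vscale (a + b) x = vscale a x + vscale b x" for a b and x :: "'v pvec"
    by (rule ext) (simp add: vscale_def distrib_right)
  show "vscale a (vscale b x) = vscale (a * b) x" for a b and x :: "'v pvec"
    by (rule ext) (simp add: vscale_def mult.assoc)
  show "vscale 1 x = x" for x :: "'v pvec"
    by (rule ext) (simp add: vscale_def)
qed
interpretation pvec: module "vscale :: 'v mpoly \<Rightarrow> 'v pvec \<Rightarrow> 'v pvec"
  by (rule module_vscale)

lemma coset_scale_coset:
  assumes "ideal.subspace I"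
  shows "coset_scale I r (x +o I) = (r * x) +o I"
proof -
  have "r *o (x +o I) + I = (r * x) +o (r *o I + I)"
    by (simp add: set_times_plus_distrib set_plus_rearrange3)
  also have "r *o I + I = I"
  proof
    show "r *o I + I \<subseteq> I"
      using ideal.subspace_add[OF assms] ideal.subspace_scale[OF assms]
      by (auto elim!: set_plus_elim simp: elt_set_times_def)
    have "0 \<in> r *o I"
      using ideal.subspace_0[OF assms] by (force simp: elt_set_times_def)
    then show "I \<subseteq> r *o I + I"
      by (rule set_zero_plus2)
  qed
  finally show ?thesis
    by (simp add: coset_scale_def)
qed

text \<open>Elements of \<open>Hom\<^sub>P(U, P/I)\<close> are handled through \<open>P\<close>-valued lifts, which are linear only
  modulo \<open>I\<close>.\<close>

definition linear_mod ::
  "('r::comm_ring_1 \<Rightarrow> 'm::ab_group_add \<Rightarrow> 'm) \<Rightarrow> 'm set \<Rightarrow> 'r set \<Rightarrow> ('m \<Rightarrow> 'r) \<Rightarrow> bool" where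
  "linear_mod s U I F \<longleftrightarrow> (\<forall>x\<in>U. \<forall>y\<in>U. F (x + y) - (F x + F y) \<in> I) \<and>
     (\<forall>r. \<forall>x\<in>U. F (s r x) - r * F x \<in> I)"

lemma hom_quot_lift:
  assumes "module s" "module.subspace s U" "ideal.subspace I" "\<phi> \<in> hom_quot s U I"
  obtains F where "linear_mod s U I F" "\<And>x. x \<in> U \<Longrightarrow> \<phi> x = F x +o I"
proof -
  interpret s: module s by fact
  define F where "F x = (SOME y. \<phi> x = y +o I)" for x
  have "\<exists>y. \<phi> x = y +o I" if "x \<in> U" for x
    using assms(4) that by (auto simp: hom_quot_def quot_def PiE_def Pi_def image_iff)
  then have F: "\<phi> x = F x +o I" if "x \<in> U" for x
    unfolding F_def using that by (metis (mono_tags) someI_ex)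
  have U: "x + y \<in> U" "s r x \<in> U" if "x \<in> U" "y \<in> U" for x y r
    using that assms(2) by (auto simp: s.subspace_add s.subspace_scale)
  have "linear_mod s U I F"
    unfolding linear_mod_def
  proof (intro conjI ballI allI)
    fix x y assume xy: "x \<in> U" "y \<in> U"
    then have "\<phi> (x + y) = \<phi> x + \<phi> y"
      using assms(4) by (auto simp: hom_quot_def)
    then show "F (x + y) - (F x + F y) \<in> I"
      using xy by (simp add: F U ideal.coset_add[OF assms(3)] ideal.coset_eq_iff[OF assms(3)])
  next
    fix x r assume x: "x \<in> U"
    then have "\<phi> (s r x) = coset_scale I r (\<phi> x)"
      using assms(4) by (auto simp: hom_quot_def)
    then show "F (s r x) - r * F x \<in> I"
      using x by (simp add: F U coset_scale_coset[OF assms(3)] ideal.coset_eq_iff[OF assms(3)])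
  qed
  with F that show ?thesis by blast
qed

lemma hom_quotI:
  assumes "module s" "module.subspace s U" "ideal.subspace I" "linear_mod s U I F"
    "\<phi> \<in> extensional U" "\<And>x. x \<in> U \<Longrightarrow> \<phi> x = F x +o I"
  shows "\<phi> \<in> hom_quot s U I"
proof -
  interpret s: module s by fact
  have U: "x + y \<in> U" "s r x \<in> U" if "x \<in> U" "y \<in> U" for x y r
    using that assms(2) by (auto simp: s.subspace_add s.subspace_scale)
  show ?thesis
    using assms(4-6) U
    by (auto simp: hom_quot_def quot_def PiE_def linear_mod_def coset_scale_coset[OF assms(3)]
        ideal.coset_add[OF assms(3)] ideal.coset_eq_iff[OF assms(3)])
qed

lemma linear_mod_zero:
  assumes "module s" "module.subspace s U" "ideal.subspace I" "linear_mod s U I F"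
  shows "F 0 \<in> I"
proof -
  interpret s: module s by fact
  have "0 \<in> U" using assms(2) by (rule s.subspace_0)
  then have "F (s 0 0) - 0 * F 0 \<in> I" using assms(4) unfolding linear_mod_def by blast
  then show ?thesis by simp
qed

lemma linear_mod_sum:
  assumes "module s" "module.subspace s U" "ideal.subspace I" "linear_mod s U I F"
    and "finite A" "\<And>i. i \<in> A \<Longrightarrow> x i \<in> U"
  shows "F (\<Sum>i\<in>A. s (r i) (x i)) - (\<Sum>i\<in>A. r i * F (x i)) \<in> I"
  using assms(5,6)
proof (induction A)
  case empty
  then show ?case using linear_mod_zero[OF assms(1-4)] by simp
next
  interpret s: module s by fact
  case (insert i A)
  let ?S = "\<Sum>i\<in>A. s (r i) (x i)"
  have U: "s (r i) (x i) \<in> U" "?S \<in> U"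
    using insert.prems assms(2) by (auto intro!: s.subspace_scale s.subspace_sum)
  then have "F (s (r i) (x i) + ?S) - (F (s (r i) (x i)) + F ?S) \<in> I"
    using assms(4) by (auto simp: linear_mod_def)
  moreover have "F (s (r i) (x i)) - r i * F (x i) \<in> I"
    using assms(4) insert.prems by (auto simp: linear_mod_def)
  moreover have "F ?S - (\<Sum>i\<in>A. r i * F (x i)) \<in> I"
    using insert by simp
  ultimately have "(F (s (r i) (x i) + ?S) - (F (s (r i) (x i)) + F ?S)) +
      ((F (s (r i) (x i)) - r i * F (x i)) + (F ?S - (\<Sum>i\<in>A. r i * F (x i)))) \<in> I"
    by (intro ideal.subspace_add[OF assms(3)])
  with insert show ?case by (simp add: algebra_simps)
qed

lemma linear_mod_neg:
  assumes "module s" "linear_mod s U I F" "x \<in> U"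
  shows "F (- x) + F x \<in> I"
proof -
  interpret s: module s by fact
  have "F (s (-1) x) - (-1) * F x \<in> I" using assms(2,3) unfolding linear_mod_def by blast
  then show ?thesis by simp
qed

lemma linear_mod_kernel:
  assumes "module s" "module.subspace s U" "ideal.subspace I" "linear_mod s U I F"
  shows "module.subspace s {x \<in> U. F x \<in> I}"
proof -
  interpret s: module s by fact
  note add = ideal.subspace_add[OF assms(3)]
  show ?thesis
  proof (rule s.subspaceI)
    show "0 \<in> {x \<in> U. F x \<in> I}"
      using s.subspace_0[OF assms(2)] linear_mod_zero[OF assms] by simp
  next
    fix x y assume xy: "x \<in> {x \<in> U. F x \<in> I}" "y \<in> {x \<in> U. F x \<in> I}"
    then have "F (x + y) - (F x + F y) \<in> I" "F x + F y \<in> I"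
      using assms(4) add unfolding linear_mod_def by blast+
    from add[OF this] xy show "x + y \<in> {x \<in> U. F x \<in> I}"
      by (simp add: s.subspace_add[OF assms(2)])
  next
    fix c x assume x: "x \<in> {x \<in> U. F x \<in> I}"
    then have "F (s c x) - c * F x \<in> I" "c * F x \<in> I"
      using assms(4) ideal.subspace_scale[OF assms(3)] unfolding linear_mod_def by blast+
    from add[OF this] x show "s c x \<in> {x \<in> U. F x \<in> I}"
      by (simp add: s.subspace_scale[OF assms(2)])
  qed
qed

section \<open>Monomials and the Stanley-Reisner ideal\<close>

definition expo :: "('v::finite \<Rightarrow> int) \<Rightarrow> 'v \<Rightarrow>\<^sub>0 nat" where
  "expo d = (\<Sum>v\<in>UNIV. Poly_Mapping.single v (nat (d v)))"

lemma lookup_expo [simp]: "Poly_Mapping.lookup (expo d) v = nat (d v)"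
  by (simp add: expo_def lookup_sum lookup_single when_def)

lemma keys_expo: "Poly_Mapping.keys (expo d) = {v. 0 < d v}"
  by (auto simp: in_keys_iff)

lemma mon_eq: "mon z d = (if \<forall>v. 0 \<le> d v then Poly_Mapping.single (expo d) z else 0)"
  by (simp add: mon_def expo_def)

lemma expo_add:
  assumes "\<forall>v. 0 \<le> d v" "\<forall>v. 0 \<le> e v"
  shows "expo (d + e) = expo d + expo e"
  using assms by (intro poly_mapping_eqI) (simp add: lookup_add nat_add_distrib)

lemma mon_zero [simp]: "mon 0 d = 0"
  by (simp add: mon_eq)

lemma mon_add: "mon (z + w) d = mon z d + mon w d"
  by (simp add: mon_eq single_add)

lemma mon_diff: "mon (z - w) d = mon z d - mon w d"
  by (simp add: mon_eq single_diff)

lemma mon_eq_0: "\<not> (\<forall>v. 0 \<le> d v) \<Longrightarrow> mon z d = 0"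
  by (auto simp: mon_eq)

text \<open>As \<open>mon\<close> vanishes on degrees with a negative entry, a factor may be zero although the sum of the
  two degrees is nonnegative; the hypotheses exclude this when both coefficients are nonzero.\<close>
lemma mon_mult:
  assumes "z \<noteq> 0 \<Longrightarrow> w \<noteq> 0 \<Longrightarrow> \<forall>v. 0 \<le> d v" "z \<noteq> 0 \<Longrightarrow> w \<noteq> 0 \<Longrightarrow> \<forall>v. 0 \<le> e v"
  shows "mon z d * mon w e = mon (z * w) (d + e)"
proof (cases "z = 0 \<or> w = 0")
  case False
  with assms show ?thesis
    by (auto simp: mon_eq mult_single expo_add)
qed auto

lemma single_eq_mon: "Poly_Mapping.single k z = mon z (\<lambda>v. int (Poly_Mapping.lookup k v))"
proof -
  have "expo (\<lambda>v. int (Poly_Mapping.lookup k v)) = k"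
    by (rule poly_mapping_eqI) simp
  then show ?thesis by (simp add: mon_eq)
qed

lemma mon_mult_range:
  assumes "f \<in> range (\<lambda>z. mon z d)" "g \<in> range (\<lambda>z. mon z e)"
  shows "f * g \<in> range (\<lambda>z. mon z (d + e))"
proof -
  obtain z w where fg: "f = mon z d" "g = mon w e" using assms by auto
  show ?thesis
  proof (cases "(\<forall>v. 0 \<le> d v) \<and> (\<forall>v. 0 \<le> e v)")
    case True
    then show ?thesis by (simp add: fg mon_mult)
  next
    case False
    then have "f * g = mon 0 (d + e)" by (auto simp: fg mon_eq)
    then show ?thesis by blast
  qed
qed

lemma mon_sum_range:
  assumes "\<And>i. i \<in> A \<Longrightarrow> f i \<in> range (\<lambda>z. mon z d)"
  shows "sum f A \<in> range (\<lambda>z. mon z d)"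
  using assms
proof (induction A rule: infinite_finite_induct)
  case (insert i A)
  then have "f i \<in> range (\<lambda>z. mon z d)" "sum f A \<in> range (\<lambda>z. mon z d)" by auto
  then obtain z w where "f i = mon z d" "sum f A = mon w d" by blast
  then have "sum f (insert i A) = mon (z + w) d" using insert by (simp add: mon_add)
  then show ?case by blast
qed (use mon_zero in \<open>auto simp: image_iff intro!: exI[of _ 0]\<close>)

lemma mpoly_eq_sum_monomials:
  "f = (\<Sum>k\<in>Poly_Mapping.keys f. Poly_Mapping.single k (Poly_Mapping.lookup f k))"
  by (rule poly_mapping_eqI)
    (auto simp: lookup_sum lookup_single when_def sum.delta in_keys_iff)

lemma SR_ideal_subspace: "ideal.subspace (SR_ideal X)"
  by (simp add: SR_ideal_def)

lemma xmon_in_SR_ideal: "p \<notin> X \<Longrightarrow> xmon p \<in> SR_ideal X"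
  unfolding SR_ideal_def by (rule ideal.span_base) auto

lemma mon_in_SR_ideal:
  assumes "{v. 0 < d v} \<notin> X"
  shows "mon z d \<in> SR_ideal X"
proof (cases "\<forall>v. 0 \<le> d v")
  case True
  let ?s = "{v. 0 < d v}"
  have "mon z d = mon z (d - indicator ?s) * xmon ?s"
    unfolding xmon_def using True by (subst mon_mult) (auto simp: indicator_def)
  then show ?thesis
    using ideal.subspace_scale[OF SR_ideal_subspace xmon_in_SR_ideal[OF assms]] by simp
next
  case False
  then show ?thesis
    using ideal.subspace_0[OF SR_ideal_subspace] by (simp only: mon_eq_0 not_False_eq_True)
qed

text \<open>Multiplication by a monomial enlarges supports, and supersets of nonfaces are nonfaces. Hence the
  polynomials all of whose terms are supported on nonfaces form an ideal.\<close>
lemma keys_SR_ideal: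
  assumes X: "simplicial_complex X" and f: "f \<in> SR_ideal (X :: 'v::finite set set)" and k: "k \<in> Poly_Mapping.keys f"
  shows "Poly_Mapping.keys k \<notin> X"
proof -
  let ?J = "{f :: 'v::finite mpoly. \<forall>k\<in>Poly_Mapping.keys f. Poly_Mapping.keys k \<notin> X}"
  have "SR_ideal X \<subseteq> ?J"
    unfolding SR_ideal_def
  proof (rule ideal.span_minimal)
    have "Poly_Mapping.keys (expo (indicator p)) = p" for p :: "'v set"
      by (auto simp: keys_expo indicator_def)
    then show "{xmon p | p. p \<notin> X} \<subseteq> ?J"
      by (auto simp: xmon_def mon_eq split: if_splits)
    show "ideal.subspace ?J"
    proof (rule ideal.subspaceI)
      show "0 \<in> ?J" by simp
      show "f + g \<in> ?J" if "f \<in> ?J" "g \<in> ?J" for f g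
        using that keys_add[of f g] by auto
      show "c * f \<in> ?J" if f: "f \<in> ?J" for c f
      proof clarify
        fix k assume "k \<in> Poly_Mapping.keys (c * f)" and kX: "Poly_Mapping.keys k \<in> X"
        then obtain k1 k2 where k2: "k2 \<in> Poly_Mapping.keys f" and k: "k = k1 + k2"
          using keys_mult[of c f] by blast
        have "Poly_Mapping.keys k2 \<subseteq> Poly_Mapping.keys k"
          by (auto simp: k in_keys_iff lookup_add)
        with kX X have "Poly_Mapping.keys k2 \<in> X" by (auto simp: simplicial_complex_def)
        with f k2 show False by auto
      qed
    qed
  qed
  with f k show ?thesis by auto
qed

lemma mon_in_SR_ideal_iff:
  assumes X: "simplicial_complex X" and "\<forall>v. 0 \<le> d v" "z \<noteq> 0"
  shows "mon z d \<in> SR_ideal X \<longleftrightarrow> {v. 0 < d v} \<notin> X"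
proof
  assume "mon z d \<in> SR_ideal X"
  from keys_SR_ideal[OF X this, of "expo d"] assms(2,3) show "{v. 0 < d v} \<notin> X"
    by (simp add: mon_eq keys_expo)
qed (rule mon_in_SR_ideal)

section \<open>Relations and the module \<open>T\<^sup>2\<close>\<close>

lemma pairing_add_left: "pairing X (r + r') u = pairing X r u + pairing X r' u"
  by (simp add: pairing_def sum.distrib distrib_right)

lemma pairing_diff_left: "pairing X (r - r') u = pairing X r u - pairing X r' u"
  by (simp add: pairing_def sum_subtractf left_diff_distrib)

lemma pairing_scale_left: "pairing X (vscale f r) u = f * pairing X r u"
  by (simp add: pairing_def vscale_def sum_distrib_left mult.assoc)

lemma pairing_add_right: "pairing X r (u + u') = pairing X r u + pairing X r u'"
  by (simp add: pairing_def sum.distrib distrib_left)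

lemma pairing_diff_right: "pairing X r (u - u') = pairing X r u - pairing X r u'"
  by (simp add: pairing_def sum_subtractf right_diff_distrib)

lemmas pairing_linear = pairing_add_left pairing_diff_left pairing_scale_left

lemma pairing_basis_vec: "p \<notin> X \<Longrightarrow> pairing X (basis_vec p) u = u p"
  by (simp add: pairing_def basis_vec_def if_distrib[of "\<lambda>x. x * _"] sum.delta cong: if_cong)

lemma pairing_Rel_gen:
  assumes "p \<notin> X" "q \<notin> X"
  shows "pairing X (Rel_gen p q) u = xmon (q - p) * u p - xmon (p - q) * u q"
  using assms by (simp add: Rel_gen_def pairing_linear pairing_basis_vec)

lemma pairing_in_ideal:
  assumes "ideal.subspace I" "\<And>p. p \<notin> X \<Longrightarrow> u p \<in> I"
  shows "pairing X r u \<in> I"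
  unfolding pairing_def using assms
  by (auto intro!: ideal.subspace_sum ideal.subspace_scale)

lemma gen_map_in_SR_ideal: "gen_map X r \<in> SR_ideal X"
  unfolding gen_map_def by (intro pairing_in_ideal SR_ideal_subspace xmon_in_SR_ideal)

lemma free_mod_subspace: "pvec.subspace (free_mod X)"
  by (rule pvec.subspaceI) (auto simp: free_mod_def vscale_def)

lemma Rel_subspace: "pvec.subspace (Rel X)"
proof (rule pvec.subspaceI)
  show "0 \<in> Rel X"
    by (simp add: Rel_def pvec.subspace_0[OF free_mod_subspace]) (simp add: gen_map_def pairing_def)
qed (auto simp: Rel_def gen_map_def pairing_linear
    intro: pvec.subspace_add[OF free_mod_subspace] pvec.subspace_scale[OF free_mod_subspace])

lemma Rel0_subspace: "pvec.subspace (Rel0 X)"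
  by (simp add: Rel0_def)

lemma Rel0_subset_Rel: "Rel0 X \<subseteq> Rel X"
  unfolding Rel0_def
proof (rule pvec.span_minimal[OF _ Rel_subspace], clarify)
  fix e f :: "'a pvec" assume "e \<in> free_mod X" "f \<in> free_mod X"
  then have "vscale (gen_map X f) e - vscale (gen_map X e) f \<in> free_mod X"
    by (intro pvec.subspace_diff[OF free_mod_subspace] pvec.subspace_scale[OF free_mod_subspace])
  then show "vscale (gen_map X f) e - vscale (gen_map X e) f \<in> Rel X"
    by (simp add: Rel_def) (simp add: gen_map_def pairing_linear mult.commute)
qed

lemma sum_fun_apply: "(\<Sum>i\<in>A. f i) x = (\<Sum>i\<in>A. f i x)"
  by (induction A rule: infinite_finite_induct) auto

lemma free_mod_expansion:
  fixes r :: "'v::finite pvec"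
  assumes "r \<in> free_mod X"
  shows "r = (\<Sum>p | p \<notin> X. vscale (r p) (basis_vec p))"
proof
  fix q
  have "(\<Sum>p | p \<notin> X. vscale (r p) (basis_vec p)) q = (\<Sum>p | p \<notin> X. if p = q then r q else 0)"
    unfolding sum_fun_apply by (rule sum.cong) (auto simp: vscale_def basis_vec_def)
  also have "\<dots> = r q"
    using assms by (auto simp: free_mod_def)
  finally show "r q = (\<Sum>p | p \<notin> X. vscale (r p) (basis_vec p)) q" by simp
qed

text \<open>A homomorphism on the free module is determined by its values on the basis, so it is the pairing
  with a vector \<open>v\<close>. This replaces homomorphisms by vectors, which can be added and subtracted.\<close>
lemma T2_class_iff:
  "h' \<in> T2_class X h \<longleftrightarrow> h' \<in> Hom_Rel X \<and> (\<exists>v. \<forall>r\<in>Rel X.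
     h' (r +o Rel0 X) = h (r +o Rel0 X) + (pairing X r v +o SR_ideal X))"
proof -
  let ?I = "SR_ideal X"
  have *: "\<exists>v. \<forall>r\<in>free_mod X. k r = pairing X r v +o ?I"
    if k: "k \<in> hom_quot vscale (free_mod X) ?I" for k
  proof -
    obtain K where K: "linear_mod vscale (free_mod X) ?I K"
      and kK: "\<And>x. x \<in> free_mod X \<Longrightarrow> k x = K x +o ?I"
      using hom_quot_lift[OF module_vscale free_mod_subspace SR_ideal_subspace k] by blast
    have "K r - pairing X r (\<lambda>p. K (basis_vec p)) \<in> ?I" if "r \<in> free_mod X" for r
    proof -
      have "K (\<Sum>p | p \<notin> X. vscale (r p) (basis_vec p)) - (\<Sum>p | p \<notin> X. r p * K (basis_vec p)) \<in> ?I"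
        by (rule linear_mod_sum[OF module_vscale free_mod_subspace SR_ideal_subspace K])
          (auto simp: free_mod_def basis_vec_def)
      then show ?thesis
        by (simp add: pairing_def flip: free_mod_expansion[OF that])
    qed
    then show ?thesis
      using kK ideal.coset_eq_iff[OF SR_ideal_subspace] by metis
  qed
  have **: "(\<lambda>r\<in>free_mod X. pairing X r v +o ?I) \<in> hom_quot vscale (free_mod X) ?I" for v
    by (rule hom_quotI[OF module_vscale free_mod_subspace SR_ideal_subspace])
      (auto simp: linear_mod_def pairing_linear ideal.subspace_0[OF SR_ideal_subspace])
  have Rel: "Rel X \<subseteq> free_mod X" by (auto simp: Rel_def)
  show ?thesis
    unfolding T2_class_def mem_Collect_eq
  proof (rule conj_cong[OF refl], rule iffI)
    assume "\<exists>k\<in>hom_quot vscale (free_mod X) ?I.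
      \<forall>r\<in>Rel X. h' (r +o Rel0 X) = h (r +o Rel0 X) + k r"
    with * Rel show "\<exists>v. \<forall>r\<in>Rel X. h' (r +o Rel0 X) = h (r +o Rel0 X) + (pairing X r v +o ?I)"
      by (metis subsetD)
  next
    assume "\<exists>v. \<forall>r\<in>Rel X. h' (r +o Rel0 X) = h (r +o Rel0 X) + (pairing X r v +o ?I)"
    then obtain v where "\<forall>r\<in>Rel X. h' (r +o Rel0 X) = h (r +o Rel0 X) + (pairing X r v +o ?I)" ..
    with Rel show "\<exists>k\<in>hom_quot vscale (free_mod X) ?I.
      \<forall>r\<in>Rel X. h' (r +o Rel0 X) = h (r +o Rel0 X) + k r"
      by (intro bexI[OF _ **[of v]]) auto
  qed
qed

lemma Hom_Rel_coset:
  assumes "h \<in> Hom_Rel X" "r \<in> Rel X"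
  obtains y where "h (r +o Rel0 X) = y +o SR_ideal X"
proof -
  have "r +o Rel0 X \<in> quot (Rel X) (Rel0 X)" using assms(2) by (auto simp: quot_def)
  with assms(1) have "h (r +o Rel0 X) \<in> SR_ring X"
    by (auto simp: Hom_Rel_def)
  with that show ?thesis by (auto simp: SR_ring_def quot_def)
qed

lemma T2_class_eqI:
  assumes "h' \<in> T2_class X h" "h \<in> Hom_Rel X"
  shows "T2_class X h' = T2_class X h"
proof -
  let ?I = "SR_ideal X"
  obtain v where v: "\<And>r. r \<in> Rel X \<Longrightarrow> h' (r +o Rel0 X) = h (r +o Rel0 X) + (pairing X r v +o ?I)"
    using assms(1) unfolding T2_class_iff by blast
  have eq: "h (r +o Rel0 X) + (pairing X r w +o ?I) = h' (r +o Rel0 X) + (pairing X r (w - v) +o ?I)"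
    if r: "r \<in> Rel X" for r w
  proof -
    obtain y where "h (r +o Rel0 X) = y +o SR_ideal X" using Hom_Rel_coset[OF assms(2) r] .
    then show ?thesis
      by (simp add: v[OF r] ideal.coset_add[OF SR_ideal_subspace] pairing_diff_right)
  qed
  have "\<exists>w'. \<forall>r\<in>Rel X. h'' (r +o Rel0 X) = h (r +o Rel0 X) + (pairing X r w' +o ?I)"
    if "\<forall>r\<in>Rel X. h'' (r +o Rel0 X) = h' (r +o Rel0 X) + (pairing X r w +o ?I)" for h'' w
    using that eq[of _ "w + v"] by (intro exI[of _ "w + v"]) simp
  moreover have "\<exists>w'. \<forall>r\<in>Rel X. h'' (r +o Rel0 X) = h' (r +o Rel0 X) + (pairing X r w' +o ?I)"
    if "\<forall>r\<in>Rel X. h'' (r +o Rel0 X) = h (r +o Rel0 X) + (pairing X r w +o ?I)" for h'' w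
    using that eq[of _ w] by (intro exI[of _ "w - v"]) simp
  ultimately show ?thesis
    by (intro set_eqI) (auto simp: T2_class_iff)
qed

text \<open>A map on \<open>R\<close> that is linear modulo \<open>I\<close> and vanishes on \<open>R\<^sub>0\<close> modulo \<open>I\<close> descends to
  \<open>R/R\<^sub>0\<close>.\<close>

lemma Hom_Rel_exists:
  assumes "linear_mod vscale (Rel X) (SR_ideal X) H" "\<And>r. r \<in> Rel0 X \<Longrightarrow> H r \<in> SR_ideal X"
  obtains h where "h \<in> Hom_Rel X" "\<And>r. r \<in> Rel X \<Longrightarrow> h (r +o Rel0 X) = H r +o SR_ideal X"
proof -
  let ?I = "SR_ideal X"
  define h where "h = (\<lambda>C\<in>quot (Rel X) (Rel0 X). H (SOME r. r \<in> Rel X \<and> C = r +o Rel0 X) +o ?I)"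
  have h: "h (r +o Rel0 X) = H r +o ?I" if r: "r \<in> Rel X" for r
  proof -
    define r' where "r' = (SOME r'. r' \<in> Rel X \<and> r +o Rel0 X = r' +o Rel0 X)"
    have r': "r' \<in> Rel X \<and> r +o Rel0 X = r' +o Rel0 X"
      unfolding r'_def by (rule someI[of _ r]) (use r in simp)
    then have diff: "r - r' \<in> Rel0 X"
      by (simp add: pvec.coset_eq_iff[OF Rel0_subspace])
    then have "H (r' + (r - r')) - (H r' + H (r - r')) \<in> ?I"
      using assms(1) r' Rel0_subset_Rel unfolding linear_mod_def by blast
    then have "(H r - (H r' + H (r - r'))) + H (r - r') \<in> ?I"
      using assms(2)[OF diff] by (intro ideal.subspace_add[OF SR_ideal_subspace]) simp_all
    then have "H r - H r' \<in> ?I" by simp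
    then have "H r +o ?I = H r' +o ?I"
      by (simp add: ideal.coset_eq_iff[OF SR_ideal_subspace])
    moreover have "r +o Rel0 X \<in> quot (Rel X) (Rel0 X)"
      using r by (auto simp: quot_def)
    ultimately show ?thesis by (simp add: h_def r'_def)
  qed
  have "(\<lambda>r\<in>Rel X. h (r +o Rel0 X)) \<in> hom_quot vscale (Rel X) ?I"
    by (rule hom_quotI[OF module_vscale Rel_subspace SR_ideal_subspace assms(1)]) (auto simp: h)
  moreover have "h \<in> quot (Rel X) (Rel0 X) \<rightarrow>\<^sub>E SR_ring X"
    by (auto simp: h_def SR_ring_def quot_def)
  ultimately have "h \<in> Hom_Rel X" by (simp add: Hom_Rel_def)
  with h that show ?thesis by blast
qed

section \<open>The cup product is well defined\<close>

text \<open>Evaluating at the generators and pairing computes a homomorphism on all of \<open>I\<close>; in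
  particular a lift pairs every relation into \<open>I\<close>.\<close>

lemma pairing_lift:
  assumes "linear_mod (*) (SR_ideal X) (SR_ideal X) F"
    and "\<And>p. p \<notin> X \<Longrightarrow> u p - F (xmon p) \<in> SR_ideal X"
  shows "pairing X r u - F (gen_map X r) \<in> SR_ideal X"
proof -
  let ?I = "SR_ideal X"
  have "F (gen_map X r) - (\<Sum>p | p \<notin> X. r p * F (xmon p)) \<in> ?I"
    unfolding gen_map_def pairing_def
    by (rule linear_mod_sum[OF ideal.module_axioms SR_ideal_subspace SR_ideal_subspace assms(1)])
      (auto intro: xmon_in_SR_ideal)
  moreover have "pairing X r (\<lambda>p. u p - F (xmon p)) \<in> ?I"
    by (intro pairing_in_ideal SR_ideal_subspace assms(2))
  ultimately have "pairing X r (\<lambda>p. u p - F (xmon p)) -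
      (F (gen_map X r) - (\<Sum>p | p \<notin> X. r p * F (xmon p))) \<in> ?I"
    by (rule ideal.subspace_diff[OF SR_ideal_subspace, rotated])
  then show ?thesis
    by (simp add: pairing_def right_diff_distrib sum_subtractf)
qed

lemma Hom_I_lift:
  assumes "\<phi> \<in> Hom_I X"
  obtains F where "linear_mod (*) (SR_ideal X) (SR_ideal X) F"
    "\<And>f. f \<in> SR_ideal X \<Longrightarrow> \<phi> f = F f +o SR_ideal X"
  using hom_quot_lift[OF ideal.module_axioms SR_ideal_subspace SR_ideal_subspace
      assms[unfolded Hom_I_def]] that by blast

lemma lifts_diff:
  assumes "u \<in> lifts X \<phi>" "\<And>f. f \<in> SR_ideal X \<Longrightarrow> \<phi> f = F f +o SR_ideal X" "p \<notin> X"
  shows "u p - F (xmon p) \<in> SR_ideal X"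
  using assms(1,3) assms(2)[OF xmon_in_SR_ideal[OF assms(3)]]
  by (auto simp: lifts_def intro: set_plus_imp_minus)

lemma pairing_Rel_lift:
  assumes "\<phi> \<in> Hom_I X" "u \<in> lifts X \<phi>" "r \<in> Rel X"
  shows "pairing X r u \<in> SR_ideal X"
proof -
  let ?I = "SR_ideal X"
  obtain F where F: "linear_mod (*) ?I ?I F" "\<And>f. f \<in> ?I \<Longrightarrow> \<phi> f = F f +o ?I"
    using Hom_I_lift[OF assms(1)] by blast
  have "pairing X r u - F 0 \<in> ?I"
    using pairing_lift[OF F(1) lifts_diff[OF assms(2) F(2)], of r] assms(3) by (simp add: Rel_def)
  moreover have "F 0 \<in> ?I"
    using linear_mod_zero[OF ideal.module_axioms SR_ideal_subspace SR_ideal_subspace F(1)] .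
  ultimately show ?thesis
    using ideal.subspace_add[OF SR_ideal_subspace] by fastforce
qed

text \<open>The choices entering the cup product are made explicit, so that they can be changed one at a
  time.\<close>
definition cup_rep ::
  "'v::finite set set \<Rightarrow> ('v mpoly \<Rightarrow> 'v mpoly set) \<Rightarrow> ('v mpoly \<Rightarrow> 'v mpoly set)
    \<Rightarrow> 'v pvec \<Rightarrow> 'v pvec \<Rightarrow> ('v pvec set \<Rightarrow> 'v mpoly set) \<Rightarrow> bool" where
  "cup_rep X \<phi> \<psi> u w h \<longleftrightarrow> \<phi> \<in> Hom_I X \<and> \<psi> \<in> Hom_I X \<and> u \<in> lifts X \<phi> \<and> w \<in> lifts X \<psi> \<and>
     h \<in> Hom_Rel X \<and> (\<forall>r\<in>Rel X. h (r +o Rel0 X) = \<psi> (pairing X r u) + \<phi> (pairing X r w))"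

lemma cup_rep_commute: "cup_rep X \<phi> \<psi> u w h \<Longrightarrow> cup_rep X \<psi> \<phi> w u h"
  by (auto simp: cup_rep_def add.commute)

text \<open>On the generator \<open>j(f)e - j(e)f\<close> of \<open>R\<^sub>0\<close> the two summands of the cup product take the
  values \<open>\<langle>e,u\<rangle>\<langle>f,w\<rangle> - \<langle>f,u\<rangle>\<langle>e,w\<rangle>\<close> and its negative, so that it descends to \<open>R/R\<^sub>0\<close>.\<close>

lemma cup_rep_exists:
  assumes \<phi>: "\<phi> \<in> Hom_I X" and \<psi>: "\<psi> \<in> Hom_I X" and u: "u \<in> lifts X \<phi>" and w: "w \<in> lifts X \<psi>"
  obtains h where "cup_rep X \<phi> \<psi> u w h"
proof -
  let ?I = "SR_ideal X"
  obtain F where F: "linear_mod (*) ?I ?I F" and \<phi>F: "\<And>f. f \<in> ?I \<Longrightarrow> \<phi> f = F f +o ?I"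
    using Hom_I_lift[OF \<phi>] by blast
  have uF: "\<And>p. p \<notin> X \<Longrightarrow> u p - F (xmon p) \<in> ?I"
    by (rule lifts_diff[OF u \<phi>F])
  obtain G where G: "linear_mod (*) ?I ?I G" and \<psi>G: "\<And>f. f \<in> ?I \<Longrightarrow> \<psi> f = G f +o ?I"
    using Hom_I_lift[OF \<psi>] by blast
  have wG: "\<And>p. p \<notin> X \<Longrightarrow> w p - G (xmon p) \<in> ?I"
    by (rule lifts_diff[OF w \<psi>G])
  note add = ideal.subspace_add[OF SR_ideal_subspace]
  define H where "H r = G (pairing X r u) + F (pairing X r w)" for r
  have pu: "pairing X r u \<in> ?I" and pw: "pairing X r w \<in> ?I" if "r \<in> Rel X" for r
    using pairing_Rel_lift \<phi> \<psi> u w that by blast+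
  have lin: "linear_mod vscale (Rel X) ?I H"
    unfolding linear_mod_def
  proof (intro conjI ballI allI)
    fix x y assume "x \<in> Rel X" "y \<in> Rel X"
    then have
      "G (pairing X x u + pairing X y u) - (G (pairing X x u) + G (pairing X y u)) \<in> ?I"
      "F (pairing X x w + pairing X y w) - (F (pairing X x w) + F (pairing X y w)) \<in> ?I"
      using F G pu pw unfolding linear_mod_def by blast+
    from add[OF this] show "H (x + y) - (H x + H y) \<in> ?I"
      by (simp add: H_def pairing_linear algebra_simps)
  next
    fix x r assume "x \<in> Rel X"
    then have
      "G (r * pairing X x u) - r * G (pairing X x u) \<in> ?I"
      "F (r * pairing X x w) - r * F (pairing X x w) \<in> ?I"
      using F G pu pw unfolding linear_mod_def by blast+
    from add[OF this] show "H (vscale r x) - r * H x \<in> ?I"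
      by (simp add: H_def pairing_linear algebra_simps)
  qed
  let ?K = "{r \<in> Rel X. H r \<in> ?I}"
  have K: "pvec.subspace ?K"
    by (rule linear_mod_kernel[OF module_vscale Rel_subspace SR_ideal_subspace lin])
  have "Rel0 X \<subseteq> ?K"
    unfolding Rel0_def
  proof (rule pvec.span_minimal[OF _ K], clarify)
    fix e f :: "'a pvec" assume ef: "e \<in> free_mod X" "f \<in> free_mod X"
    let ?r = "vscale (gen_map X f) e - vscale (gen_map X e) f"
    have *: "T (gen_map X f * a - gen_map X e * b) -
        (pairing X f t * a - pairing X e t * b) \<in> ?I"
      if T: "linear_mod (*) ?I ?I T" and t: "\<And>p. p \<notin> X \<Longrightarrow> t p - T (xmon p) \<in> ?I" for T t a b
    proof -
      have j: "gen_map X r \<in> ?I" for r by (rule gen_map_in_SR_ideal)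
      \<comment> \<open>A combination of two elements, written as a sum over the index set \<open>bool\<close>.\<close>
      have "T (\<Sum>i\<in>{False, True}. (if i then a else - b) * (if i then gen_map X f else gen_map X e))
          - (\<Sum>i\<in>{False, True}. (if i then a else - b) * T (if i then gen_map X f else gen_map X e))
          \<in> ?I"
        by (rule linear_mod_sum[OF ideal.module_axioms SR_ideal_subspace SR_ideal_subspace T])
          (auto simp: j)
      then have s1: "T (gen_map X f * a - gen_map X e * b) -
          (a * T (gen_map X f) - b * T (gen_map X e)) \<in> ?I"
        by (simp add: algebra_simps)
      have s2: "a * (pairing X f t - T (gen_map X f)) \<in> ?I"
        "b * (pairing X e t - T (gen_map X e)) \<in> ?I"
        using pairing_lift[OF T t] ideal.subspace_scale[OF SR_ideal_subspace] by auto
      from ideal.subspace_diff[OF SR_ideal_subspace s1 ideal.subspace_diff[OF SR_ideal_subspace s2]]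
      show ?thesis by (simp add: algebra_simps)
    qed
    have "H ?r \<in> ?I"
      using add[OF *[OF G wG, of "pairing X e u" "pairing X f u"]
          *[OF F uF, of "pairing X e w" "pairing X f w"]]
      by (simp add: H_def pairing_linear algebra_simps)
    moreover have "?r \<in> Rel X"
      using Rel0_subset_Rel[of X] ef unfolding Rel0_def by (blast intro: pvec.span_base)
    ultimately show "?r \<in> Rel X \<and> H ?r \<in> ?I" by simp
  qed
  then have "\<And>r. r \<in> Rel0 X \<Longrightarrow> H r \<in> ?I" by blast
  from Hom_Rel_exists[OF lin this] obtain h where "h \<in> Hom_Rel X"
    "\<And>r. r \<in> Rel X \<Longrightarrow> h (r +o Rel0 X) = H r +o ?I" by blast
  then have "cup_rep X \<phi> \<psi> u w h"
    using assms by (simp add: cup_rep_def H_def \<phi>F \<psi>G pu pw ideal.coset_add[OF SR_ideal_subspace])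
  with that show ?thesis .
qed

lemma derivation_diff:
  assumes "D \<in> derivations"
  shows "D (f - g) = D f - D g"
proof -
  interpret additive D using assms by unfold_locales (simp add: derivations_def)
  show ?thesis by (rule diff)
qed

lemma derivation_zero: "D \<in> derivations \<Longrightarrow> D 0 = 0"
  using derivation_diff[of D 0 0] by simp

lemma derivations_diff:
  assumes "D \<in> derivations" "D' \<in> derivations"
  shows "(\<lambda>f. D f - D' f) \<in> derivations"
  using assms by (auto simp: derivations_def algebra_simps)

lemma derivation_pairing:
  assumes "D \<in> derivations"
  shows "D (pairing X r u) = pairing X (\<lambda>p. D (r p)) u + pairing X r (\<lambda>p. D (u p))"
proof -
  interpret additive D using assms by unfold_locales (simp add: derivations_def)
  have "D (f * g) = D f * g + f * D g" for f g
    using assms by (simp add: derivations_def algebra_simps)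
  then show ?thesis
    by (simp add: pairing_def sum sum.distrib)
qed

text \<open>Changing a representative by a derivation \<open>D\<close>, and the lift by a vector \<open>i\<close> with entries
  in \<open>I\<close>, changes the cup product by the restriction of \<open>\<langle>\<cdot>, \<psi> i + D w\<rangle>\<close>: applying \<open>D\<close> to
  \<open>\<langle>r, x\<rangle> = 0\<close> gives \<open>\<langle>r, D x\<rangle> = - \<langle>D r, x\<rangle>\<close>, and \<open>\<psi>\<close> maps the latter to \<open>- \<langle>D r, w\<rangle>\<close>, which
  cancels a part of \<open>D \<langle>r, w\<rangle> = \<langle>D r, w\<rangle> + \<langle>r, D w\<rangle>\<close>.\<close>

lemma cup_rep_change_left:
  assumes h: "cup_rep X \<phi> \<psi> u w h" and h': "cup_rep X \<phi>' \<psi> u' w h'"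
    and D: "D \<in> derivations" and \<phi>': "\<And>f. f \<in> SR_ideal X \<Longrightarrow> \<phi>' f = \<phi> f + (D f +o SR_ideal X)"
  shows "h' \<in> T2_class X h"
proof -
  let ?I = "SR_ideal X"
  note I = SR_ideal_subspace[of X]
  have mem: "\<phi> \<in> Hom_I X" "\<psi> \<in> Hom_I X" "u \<in> lifts X \<phi>" "w \<in> lifts X \<psi>"
      "\<phi>' \<in> Hom_I X" "u' \<in> lifts X \<phi>'" "h' \<in> Hom_Rel X"
    and hr: "\<And>r. r \<in> Rel X \<Longrightarrow> h (r +o Rel0 X) = \<psi> (pairing X r u) + \<phi> (pairing X r w)"
    and h'r: "\<And>r. r \<in> Rel X \<Longrightarrow> h' (r +o Rel0 X) = \<psi> (pairing X r u') + \<phi>' (pairing X r w)"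
    using h h' by (auto simp: cup_rep_def)
  obtain F where "linear_mod (*) ?I ?I F" and \<phi>F: "\<And>f. f \<in> ?I \<Longrightarrow> \<phi> f = F f +o ?I"
    using Hom_I_lift[OF mem(1)] by blast
  have uF: "\<And>p. p \<notin> X \<Longrightarrow> u p - F (xmon p) \<in> ?I"
    by (rule lifts_diff[OF mem(3) \<phi>F])
  obtain G where G: "linear_mod (*) ?I ?I G" and \<psi>G: "\<And>f. f \<in> ?I \<Longrightarrow> \<psi> f = G f +o ?I"
    using Hom_I_lift[OF mem(2)] by blast
  have wG: "\<And>p. p \<notin> X \<Longrightarrow> w p - G (xmon p) \<in> ?I"
    by (rule lifts_diff[OF mem(4) \<psi>G])
  define i where "i p = u' p - u p - D (xmon p)" for p
  define v where "v = (\<lambda>p. G (i p)) + (\<lambda>p. D (w p))"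
  have i: "i p \<in> ?I" if "p \<notin> X" for p
  proof -
    have "u' p \<in> (F (xmon p) + D (xmon p)) +o ?I"
      using mem(6) that \<phi>'[OF xmon_in_SR_ideal[OF that]] \<phi>F[OF xmon_in_SR_ideal[OF that]]
      by (auto simp: lifts_def ideal.coset_add[OF I])
    then have "u' p - (F (xmon p) + D (xmon p)) \<in> ?I" by (rule set_plus_imp_minus)
    from ideal.subspace_diff[OF I this uF[OF that]] show ?thesis
      by (simp add: i_def algebra_simps)
  qed
  have "h' (r +o Rel0 X) = h (r +o Rel0 X) + (pairing X r v +o ?I)" if r: "r \<in> Rel X" for r
  proof -
    let ?Dr = "\<lambda>p. D (r p)"
    have "D (pairing X r xmon) = 0"
      using r derivation_zero[OF D] by (simp add: Rel_def gen_map_def)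
    then have "pairing X r (\<lambda>p. D (xmon p)) = - gen_map X ?Dr"
      by (simp add: derivation_pairing[OF D] gen_map_def add_eq_0_iff)
    moreover have "u' = u + i + (\<lambda>p. D (xmon p))" by (simp add: fun_eq_iff i_def)
    ultimately have u': "pairing X r u' = pairing X r u + (pairing X r i + - gen_map X ?Dr)"
      by (simp add: pairing_add_right algebra_simps)
    have pI: "pairing X r u \<in> ?I" "pairing X r u' \<in> ?I" "pairing X r w \<in> ?I"
      using pairing_Rel_lift mem r by blast+
    have piI: "pairing X r i \<in> ?I" by (intro pairing_in_ideal I i)
    have jI: "- gen_map X ?Dr \<in> ?I"
      using ideal.subspace_neg[OF I gen_map_in_SR_ideal] .
    have G_add: "G (f + g) - (G f + G g) \<in> ?I" if "f \<in> ?I" "g \<in> ?I" for f g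
      using G that unfolding linear_mod_def by blast
    have s1: "G (pairing X r u') - (G (pairing X r u) + G (pairing X r i + - gen_map X ?Dr)) \<in> ?I"
      unfolding u' using pI piI jI by (intro G_add ideal.subspace_add[OF I])
    have s2: "G (pairing X r i + - gen_map X ?Dr) - (G (pairing X r i) + G (- gen_map X ?Dr)) \<in> ?I"
      using piI jI by (rule G_add)
    have s3: "G (- gen_map X ?Dr) + G (gen_map X ?Dr) \<in> ?I"
      using linear_mod_neg[OF ideal.module_axioms G gen_map_in_SR_ideal] .
    have s4: "G (pairing X r i) - pairing X r (\<lambda>p. G (i p)) \<in> ?I"
      unfolding pairing_def
      by (rule linear_mod_sum[OF ideal.module_axioms I I G]) (auto intro: i)
    have s5: "pairing X ?Dr w - G (gen_map X ?Dr) \<in> ?I"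
      by (rule pairing_lift[OF G wG])
    have "(G (pairing X r u') - (G (pairing X r u) + G (pairing X r i + - gen_map X ?Dr))) +
        ((G (pairing X r i + - gen_map X ?Dr) - (G (pairing X r i) + G (- gen_map X ?Dr))) +
        ((G (- gen_map X ?Dr) + G (gen_map X ?Dr)) +
        ((G (pairing X r i) - pairing X r (\<lambda>p. G (i p))) +
        (pairing X ?Dr w - G (gen_map X ?Dr))))) \<in> ?I"
      by (intro ideal.subspace_add[OF I] s1 s2 s3 s4 s5)
    then have "(G (pairing X r u') + (F (pairing X r w) + D (pairing X r w))) -
        ((G (pairing X r u) + F (pairing X r w)) + pairing X r v) \<in> ?I"
      by (simp add: v_def pairing_add_right derivation_pairing[OF D] algebra_simps)
    then show ?thesis
      by (simp add: hr[OF r] h'r[OF r] pI \<phi>' \<phi>F \<psi>G ideal.coset_add[OF I] ideal.coset_eq_iff[OF I])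
  qed
  with mem(7) show ?thesis unfolding T2_class_iff by blast
qed

lemma Hom_I_coset:
  assumes "\<phi> \<in> Hom_I X" "f \<in> SR_ideal X"
  obtains y where "\<phi> f = y +o SR_ideal X"
  using Hom_I_lift[OF assms(1)] assms(2) by metis

lemma mem_T1_class_self:
  assumes "\<phi> \<in> Hom_I X"
  shows "\<phi> \<in> T1_class X \<phi>"
proof -
  have "(\<lambda>_. 0) \<in> derivations" by (simp add: derivations_def)
  moreover have "\<phi> f = \<phi> f + (0 +o SR_ideal X)" if f: "f \<in> SR_ideal X" for f
  proof -
    obtain y where "\<phi> f = y +o SR_ideal X" using Hom_I_coset[OF assms f] .
    then show ?thesis by (simp only: ideal.coset_add[OF SR_ideal_subspace] add_0_right)
  qed
  ultimately show ?thesis using assms by (auto simp: T1_class_def intro!: bexI[of _ "\<lambda>_. 0"])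
qed

text \<open>Two members of a class differ by the difference of the derivations that relate them to its base
  point.\<close>
lemma T1_class_derivation:
  assumes \<phi>: "\<phi> \<in> T1_class X \<phi>0" and \<phi>': "\<phi>' \<in> T1_class X \<phi>0" and \<phi>0: "\<phi>0 \<in> Hom_I X"
  obtains D where "D \<in> derivations" "\<And>f. f \<in> SR_ideal X \<Longrightarrow> \<phi>' f = \<phi> f + (D f +o SR_ideal X)"
proof -
  let ?I = "SR_ideal X"
  obtain D where D: "D \<in> derivations" "\<And>f. f \<in> ?I \<Longrightarrow> \<phi> f = \<phi>0 f + (D f +o ?I)"
    using \<phi> by (auto simp: T1_class_def)
  obtain D' where D': "D' \<in> derivations" "\<And>f. f \<in> ?I \<Longrightarrow> \<phi>' f = \<phi>0 f + (D' f +o ?I)"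
    using \<phi>' by (auto simp: T1_class_def)
  have "\<phi>' f = \<phi> f + ((D' f - D f) +o ?I)" if f: "f \<in> ?I" for f
  proof -
    obtain y where "\<phi>0 f = y +o ?I" using Hom_I_coset[OF \<phi>0 f] .
    then show ?thesis using f by (simp add: D D' ideal.coset_add[OF SR_ideal_subspace])
  qed
  with derivations_diff[OF D'(1) D(1)] that show ?thesis by blast
qed

text \<open>The two representatives are changed successively: first \<open>\<phi>\<close> into \<open>\<phi>'\<close> with \<open>\<psi>\<close> fixed, then, by
  symmetry of the cup product, \<open>\<psi>\<close> into \<open>\<psi>'\<close>.\<close>
lemma cup_rep_unique:
  assumes "\<phi>0 \<in> Hom_I X" "\<psi>0 \<in> Hom_I X"
    and "\<phi> \<in> T1_class X \<phi>0" "\<phi>' \<in> T1_class X \<phi>0" "\<psi> \<in> T1_class X \<psi>0" "\<psi>' \<in> T1_class X \<psi>0"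
    and h: "cup_rep X \<phi> \<psi> u w h" and h': "cup_rep X \<phi>' \<psi>' u' w' h'"
  shows "T2_class X h' = T2_class X h"
proof -
  obtain D where D: "D \<in> derivations" "\<And>f. f \<in> SR_ideal X \<Longrightarrow> \<phi>' f = \<phi> f + (D f +o SR_ideal X)"
    using T1_class_derivation[OF assms(3,4,1)] by blast
  obtain E where E: "E \<in> derivations" "\<And>f. f \<in> SR_ideal X \<Longrightarrow> \<psi>' f = \<psi> f + (E f +o SR_ideal X)"
    using T1_class_derivation[OF assms(5,6,2)] by blast
  have mem: "\<phi>' \<in> Hom_I X" "\<psi> \<in> Hom_I X" "u' \<in> lifts X \<phi>'" "w \<in> lifts X \<psi>"
    "h \<in> Hom_Rel X" "h' \<in> Hom_Rel X"
    using h h' by (auto simp: cup_rep_def)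
  obtain g where g: "cup_rep X \<phi>' \<psi> u' w g" using cup_rep_exists[OF mem(1-4)] .
  then have "g \<in> Hom_Rel X" by (simp add: cup_rep_def)
  have "g \<in> T2_class X h" using cup_rep_change_left[OF h g D] .
  moreover have "h' \<in> T2_class X g"
    using cup_rep_change_left[OF cup_rep_commute[OF g] cup_rep_commute[OF h'] E] .
  ultimately show ?thesis
    using T2_class_eqI mem(5) \<open>g \<in> Hom_Rel X\<close> by metis
qed

theorem cup_eq_T2_class:
  assumes "\<phi>0 \<in> Hom_I X" "\<psi>0 \<in> Hom_I X" "\<phi> \<in> T1_class X \<phi>0" "\<psi> \<in> T1_class X \<psi>0"
    and h: "cup_rep X \<phi> \<psi> u w h"
  shows "cup X (T1_class X \<phi>0) (T1_class X \<psi>0) = T2_class X h"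
proof -
  have sub: "T1_class X \<chi> \<subseteq> Hom_I X" for \<chi> by (auto simp: T1_class_def)
  have "{T2_class X h | h. h \<in> Hom_Rel X \<and> (\<exists>\<phi>\<in>T1_class X \<phi>0. \<exists>\<psi>\<in>T1_class X \<psi>0.
      \<exists>u\<in>lifts X \<phi>. \<exists>w\<in>lifts X \<psi>.
        \<forall>r\<in>Rel X. h (r +o Rel0 X) = \<psi> (pairing X r u) + \<phi> (pairing X r w))} =
    {T2_class X h | h. \<exists>\<phi>\<in>T1_class X \<phi>0. \<exists>\<psi>\<in>T1_class X \<psi>0. \<exists>u w. cup_rep X \<phi> \<psi> u w h}"
    using sub unfolding cup_rep_def by blast
  also have "\<dots> = {T2_class X h}"
    using cup_rep_unique[OF assms(1,2,3) _ assms(4) _ h] assms(3,4) h by blast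
  finally show ?thesis by (simp add: cup_def)
qed


section \<open>The relations between square-free monomials\<close>

lemma xmon_mult:
  assumes "p \<inter> q = {}"
  shows "xmon p * xmon q = xmon (p \<union> q)"
proof -
  have "indicator p + indicator q = (indicator (p \<union> q) :: 'a \<Rightarrow> int)"
    using assms by (auto simp: fun_eq_iff indicator_def)
  then show ?thesis
    unfolding xmon_def by (subst mon_mult) (auto simp: indicator_def)
qed

lemma xmon_empty: "xmon {} = 1"
proof -
  have "expo (indicator ({} :: 'a set)) = 0" by (rule poly_mapping_eqI) simp
  then show ?thesis by (simp add: xmon_def mon_eq)
qed

lemma Rel_gen_in_Rel:
  assumes "p \<notin> X" "q \<notin> X"
  shows "Rel_gen p q \<in> Rel X"
proof -
  have "Rel_gen p q \<in> free_mod X"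
    using assms by (auto simp: Rel_gen_def free_mod_def vscale_def basis_vec_def)
  moreover have "gen_map X (Rel_gen p q) = 0"
    using xmon_mult[of "q - p" p] xmon_mult[of "p - q" q] assms
    by (simp add: gen_map_def pairing_Rel_gen Un_commute Int_commute)
  ultimately show ?thesis by (simp add: Rel_def)
qed

text \<open>Every monomial \<open>x\<^sup>k\<close> of \<open>I\<close> is a multiple \<open>x\<^sup>k\<^sup>-\<^sup>s x\<^sup>s\<close> of the generator given by its support
  \<open>s\<close>. The additive extension of \<open>x\<^sup>k \<mapsto> x\<^sup>k\<^sup>-\<^sup>s e\<^sub>s\<close> is a normal form of free module elements with a
  given image in \<open>P\<close>.\<close>

definition normal_form :: "'v::finite mpoly \<Rightarrow> 'v pvec" where
  "normal_form f = (\<lambda>s. \<Sum>k\<in>Poly_Mapping.keys f. if Poly_Mapping.keys k = s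
     then mon (Poly_Mapping.lookup f k) ((\<lambda>v. int (Poly_Mapping.lookup k v)) - indicator s) else 0)"

lemma normal_form_zero: "normal_form 0 = 0"
  by (simp add: normal_form_def zero_fun_def)

lemma normal_form_add: "normal_form (f + g) = normal_form f + normal_form g"
proof
  fix s
  show "normal_form (f + g) s = (normal_form f + normal_form g) s"
    unfolding normal_form_def plus_fun_apply
    by (rule setsum_keys_plus_distrib) (auto simp: mon_add fun_diff_def)
qed

lemma normal_form_mon:
  assumes "\<forall>v. 0 \<le> d v"
  shows "normal_form (mon z d) =
    vscale (mon z (d - indicator {v. 0 < d v})) (basis_vec {v. 0 < d v})"
proof (cases "z = 0")
  case False
  then show ?thesis
    using assms
    by (auto simp: normal_form_def mon_eq[of z d] keys_expo vscale_def basis_vec_def fun_eq_iff)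
qed (simp add: normal_form_zero)

text \<open>For \<open>s\<close> the support of \<open>x\<^sup>m x\<^sup>p\<close>, the element \<open>x\<^sup>m e\<^sub>p\<close> differs from its normal form by the multiple
  of \<open>R\<^sub>p\<^sub>,\<^sub>s\<close> by \<open>x\<^sup>m x\<^sup>p / x\<^sup>s\<close>; both sides are additive. A relation has image \<open>0\<close>, so its normal form
  is \<open>0\<close>.\<close>
lemma free_mod_normal_form:
  assumes X: "simplicial_complex X" and r: "r \<in> free_mod X"
  shows "r - normal_form (gen_map X r) \<in> pvec.span {Rel_gen p q | p q. p \<notin> X \<and> q \<notin> X}"
proof -
  define S where "S = pvec.span {Rel_gen p q | p q. p \<notin> X \<and> q \<notin> X}"
  define Q where "Q = {r. r - normal_form (gen_map X r) \<in> S}"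
  have zero: "0 \<in> Q"
    by (simp add: Q_def S_def gen_map_def pairing_def normal_form_zero pvec.span_zero)
  have add: "x + y \<in> Q" if "x \<in> Q" "y \<in> Q" for x y
  proof -
    have "(x - normal_form (gen_map X x)) + (y - normal_form (gen_map X y)) \<in> S"
      using that by (auto simp: Q_def S_def intro: pvec.span_add)
    moreover have "gen_map X (x + y) = gen_map X x + gen_map X y"
      by (simp add: gen_map_def pairing_add_left)
    ultimately show ?thesis
      by (simp add: Q_def normal_form_add algebra_simps)
  qed
  have sum: "sum t A \<in> Q" if "\<And>i. i \<in> A \<Longrightarrow> t i \<in> Q" for t :: "'i \<Rightarrow> 'a pvec" and A
    using that by (induction A rule: infinite_finite_induct) (auto simp: zero add)
  have sum': "sum t A \<in> Q" if "\<And>i. i \<in> A \<Longrightarrow> t i \<in> Q" for t :: "('a \<Rightarrow>\<^sub>0 nat) \<Rightarrow> 'a pvec" and A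
    using that by (induction A rule: infinite_finite_induct) (auto simp: zero add)
  have mono: "vscale (mon z d) (basis_vec p) \<in> Q" if p: "p \<notin> X" and d: "\<forall>v. 0 \<le> d v" for z d p
  proof -
    \<comment> \<open>\<open>?s\<close> is the support of the image monomial; it contains the nonface \<open>p\<close>.\<close>
    let ?s = "{v. 0 < (d + indicator p :: 'a \<Rightarrow> int) v}"
    have ps: "p \<subseteq> ?s" using d by (auto simp: indicator_def add_nonneg_pos)
    with p X have s: "?s \<notin> X" by (auto simp: simplicial_complex_def)
    have ge: "\<forall>v. 0 \<le> (d + indicator p - indicator ?s :: 'a \<Rightarrow> int) v"
      using d by (auto simp: indicator_def)
    have "gen_map X (vscale (mon z d) (basis_vec p)) = mon z (d + indicator p)"
      using p d unfolding gen_map_def pairing_scale_left pairing_basis_vec[OF p] xmon_def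
      by (subst mon_mult) (auto simp: indicator_def)
    moreover have "\<forall>v. 0 \<le> (d + indicator p :: 'a \<Rightarrow> int) v"
      using d by (auto simp: indicator_def)
    ultimately have nf: "normal_form (gen_map X (vscale (mon z d) (basis_vec p))) =
        vscale (mon z (d + indicator p - indicator ?s)) (basis_vec ?s)"
      using normal_form_mon by metis
    have "d + indicator p - indicator ?s + indicator (?s - p) = d"
      using ps by (auto simp: fun_eq_iff indicator_def)
    then have "mon z (d + indicator p - indicator ?s) * xmon (?s - p) = mon z d"
      using mon_mult[of z 1 "d + indicator p - indicator ?s" "indicator (?s - p)"] ge
      unfolding xmon_def by (simp only: mult_1_right) (auto simp: indicator_def)
    moreover have "p - ?s = {}" using ps by blast
    ultimately have "vscale (mon z d) (basis_vec p) -
        normal_form (gen_map X (vscale (mon z d) (basis_vec p))) =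
        vscale (mon z (d + indicator p - indicator ?s)) (Rel_gen p ?s)"
      unfolding nf Rel_gen_def pvec.scale_right_diff_distrib pvec.scale_scale
      by (simp only: xmon_empty mult_1_right)
    moreover have "Rel_gen p ?s \<in> S"
      unfolding S_def using p s by (blast intro: pvec.span_base)
    ultimately show ?thesis
      by (simp add: Q_def) (simp add: S_def pvec.span_scale)
  qed
  have "vscale f (basis_vec p) \<in> Q" if p: "p \<notin> X" for f p
  proof -
    have "vscale f (basis_vec p) = (\<Sum>k\<in>Poly_Mapping.keys f.
        vscale (Poly_Mapping.single k (Poly_Mapping.lookup f k)) (basis_vec p))"
      by (subst mpoly_eq_sum_monomials) (rule pvec.scale_sum_left)
    also have "\<dots> \<in> Q"
      by (rule sum') (simp add: single_eq_mon mono[OF p])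
    finally show ?thesis .
  qed
  then have "(\<Sum>p | p \<notin> X. vscale (r p) (basis_vec p)) \<in> Q"
    by (intro sum) auto
  then show ?thesis
    by (simp add: Q_def S_def flip: free_mod_expansion[OF r])
qed

theorem Rel_generated:
  assumes "simplicial_complex X"
  shows "Rel X \<subseteq> pvec.span {Rel_gen p q | p q. p \<notin> X \<and> q \<notin> X}"
  using free_mod_normal_form[OF assms] by (fastforce simp: Rel_def normal_form_zero)

section \<open>The grading\<close>

lemma SR_degree_add:
  assumes "C \<in> SR_degree X d" "C' \<in> SR_degree X d"
  shows "C + C' \<in> SR_degree X d"
proof -
  obtain z w where "C = mon z d +o SR_ideal X" "C' = mon w d +o SR_ideal X"
    using assms by (auto simp: SR_degree_def)
  then have "C + C' = mon (z + w) d +o SR_ideal X"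
    by (simp add: ideal.coset_add[OF SR_ideal_subspace] mon_add)
  then show ?thesis by (auto simp: SR_degree_def)
qed

lemma homogeneous_lifts:
  assumes "\<phi> \<in> Hom_I_degree X c"
  obtains u where "u \<in> lifts X \<phi>" "\<And>p. u p \<in> range (\<lambda>z. mon z (indicator p + c))"
proof -
  have "\<exists>y. y \<in> range (\<lambda>z. mon z (indicator p + c)) \<and> (p \<notin> X \<longrightarrow> y \<in> \<phi> (xmon p))" for p
  proof (cases "p \<in> X")
    case False
    have "xmon p \<in> range (\<lambda>z. mon z (indicator p))" by (simp add: xmon_def)
    with assms xmon_in_SR_ideal[OF False] have "\<phi> (xmon p) \<in> SR_degree X (indicator p + c)"
      by (auto simp: Hom_I_degree_def)
    then show ?thesis
      using ideal.mem_coset_self[OF SR_ideal_subspace] by (fastforce simp: SR_degree_def)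
  qed auto
  then obtain u where "\<And>p. u p \<in> range (\<lambda>z. mon z (indicator p + c)) \<and> (p \<notin> X \<longrightarrow> u p \<in> \<phi> (xmon p))"
    by metis
  then show ?thesis by (intro that[of u]) (auto simp: lifts_def)
qed

lemma pairing_homogeneous:
  assumes "\<And>p. r p \<in> range (\<lambda>z. mon z (d - indicator p))" "\<And>p. u p \<in> range (\<lambda>z. mon z (indicator p + c))"
  shows "pairing X r u \<in> range (\<lambda>z. mon z (d + c))"
  unfolding pairing_def
proof (rule mon_sum_range)
  fix p
  have "d - indicator p + (indicator p + c) = d + c" by (simp add: fun_eq_iff)
  with mon_mult_range[OF assms, of p p] show "r p * u p \<in> range (\<lambda>z. mon z (d + c))" by simp
qed

lemma cup_rep_degree:
  assumes \<phi>: "\<phi> \<in> Hom_I_degree X c" and \<psi>: "\<psi> \<in> Hom_I_degree X e" and h: "cup_rep X \<phi> \<psi> u w h"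
    and u: "\<And>p. u p \<in> range (\<lambda>z. mon z (indicator p + c))"
    and w: "\<And>p. w p \<in> range (\<lambda>z. mon z (indicator p + e))"
  shows "h \<in> Hom_Rel_degree X (c + e)"
proof -
  have mem: "\<phi> \<in> Hom_I X" "\<psi> \<in> Hom_I X" "u \<in> lifts X \<phi>" "w \<in> lifts X \<psi>" "h \<in> Hom_Rel X"
    and hr: "\<And>r. r \<in> Rel X \<Longrightarrow> h (r +o Rel0 X) = \<psi> (pairing X r u) + \<phi> (pairing X r w)"
    using h by (auto simp: cup_rep_def)
  have "h (r +o Rel0 X) \<in> SR_degree X (d + (c + e))"
    if r: "r \<in> Rel X" and rd: "\<And>p. r p \<in> range (\<lambda>z. mon z (d - indicator p))" for r d
  proof -
    have "\<psi> (pairing X r u) \<in> SR_degree X ((d + c) + e)"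
      using \<psi> pairing_Rel_lift[OF mem(1,3) r] pairing_homogeneous[OF rd u]
      by (simp add: Hom_I_degree_def)
    moreover have "\<phi> (pairing X r w) \<in> SR_degree X ((d + e) + c)"
      using \<phi> pairing_Rel_lift[OF mem(2,4) r] pairing_homogeneous[OF rd w]
      by (simp add: Hom_I_degree_def)
    ultimately show ?thesis
      unfolding hr[OF r] by (intro SR_degree_add) (simp_all add: ac_simps)
  qed
  with mem(5) show ?thesis by (simp add: Hom_Rel_degree_def)
qed

lemma Rel_gen_homogeneous:
  "Rel_gen p q s \<in> range (\<lambda>z. mon z (indicator (p \<union> q) - indicator s))"
proof -
  have "xmon (q - p) = mon 1 (indicator (p \<union> q) - indicator p)"
    unfolding xmon_def by (rule arg_cong[of _ _ "mon 1"]) (auto simp: fun_eq_iff indicator_def)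
  moreover have "xmon (p - q) = mon 1 (indicator (p \<union> q) - indicator q)"
    unfolding xmon_def by (rule arg_cong[of _ _ "mon 1"]) (auto simp: fun_eq_iff indicator_def)
  ultimately have "Rel_gen p q s = mon ((if s = p then 1 else 0) - (if s = q then 1 else 0))
      (indicator (p \<union> q) - indicator s)"
    by (auto simp: Rel_gen_def vscale_def basis_vec_def mon_diff)
  then show ?thesis by blast
qed

text \<open>The generators \<open>R\<^sub>p\<^sub>,\<^sub>q\<close> of \<open>R\<close> have square-free degree \<open>p \<union> q\<close>, so a homomorphism that
  lowers an exponent by more than one annihilates all of them.\<close>

lemma Hom_Rel_degree_trivial:
  assumes X: "simplicial_complex X" and h: "h \<in> Hom_Rel_degree X c" and v: "c v < - 1"
  shows "h = (\<lambda>_\<in>quot (Rel X) (Rel0 X). SR_ideal X)"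
proof -
  let ?I = "SR_ideal X"
  have hom: "(\<lambda>r\<in>Rel X. h (r +o Rel0 X)) \<in> hom_quot vscale (Rel X) ?I"
    and ext: "h \<in> extensional (quot (Rel X) (Rel0 X))"
    using h by (auto simp: Hom_Rel_degree_def Hom_Rel_def PiE_def)
  obtain H where H: "linear_mod vscale (Rel X) ?I H"
    and hH: "\<And>r. r \<in> Rel X \<Longrightarrow> (\<lambda>r\<in>Rel X. h (r +o Rel0 X)) r = H r +o ?I"
    using hom_quot_lift[OF module_vscale Rel_subspace SR_ideal_subspace hom] by blast
  have "Rel X \<subseteq> {r \<in> Rel X. H r \<in> ?I}"
  proof (rule order_trans[OF Rel_generated[OF X] pvec.span_minimal])
    show "pvec.subspace {r \<in> Rel X. H r \<in> ?I}"
      by (rule linear_mod_kernel[OF module_vscale Rel_subspace SR_ideal_subspace H])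
    show "{Rel_gen p q | p q. p \<notin> X \<and> q \<notin> X} \<subseteq> {r \<in> Rel X. H r \<in> ?I}"
    proof clarify
      fix p q assume pq: "p \<notin> X" "q \<notin> X"
      then have r: "Rel_gen p q \<in> Rel X" by (rule Rel_gen_in_Rel)
      with h Rel_gen_homogeneous[of p q]
      have "h (Rel_gen p q +o Rel0 X) \<in> SR_degree X (indicator (p \<union> q) + c)"
        by (simp add: Hom_Rel_degree_def)
      moreover have "mon z (indicator (p \<union> q) + c) = 0" for z
      proof (rule mon_eq_0)
        have "(indicator (p \<union> q) + c) v < 0" using v by (auto simp: indicator_def)
        then show "\<not> (\<forall>v. 0 \<le> (indicator (p \<union> q) + c) v)" by (meson not_le)
      qed
      ultimately have "H (Rel_gen p q) +o ?I = ?I"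
        using hH[OF r] r by (auto simp: SR_degree_def)
      with r show "Rel_gen p q \<in> Rel X \<and> H (Rel_gen p q) \<in> ?I"
        by (simp add: ideal.coset_zero_iff[OF SR_ideal_subspace])
    qed
  qed
  then have "h (r +o Rel0 X) = ?I" if "r \<in> Rel X" for r
    using that hH[OF that] by (auto simp: ideal.coset_zero_iff[OF SR_ideal_subspace])
  then have "h C = ?I" if "C \<in> quot (Rel X) (Rel0 X)" for C
    using that by (auto simp: quot_def)
  with ext show ?thesis by (auto simp: fun_eq_iff extensional_def)
qed

section \<open>Combinatorics of functions on links\<close>

text \<open>The nonface \<open>p\<close> is contained in \<open>Phi a b p \<union> b\<close>.\<close>
lemma Phi_in_N:
  assumes "simplicial_complex X" "a \<inter> b = {}" "p \<notin> X" "Phi a b p \<in> X"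
  shows "Phi a b p \<in> N X a b"
proof -
  have "p \<subseteq> Phi a b p \<union> b" by (auto simp: Phi_def)
  with assms(1,3) have "Phi a b p \<union> b \<notin> X" by (auto simp: simplicial_complex_def)
  with assms show ?thesis by (auto simp: N_def Phi_def)
qed

text \<open>The nonface \<open>p\<close> is contained in \<open>Phi a b p \<union> (b \<inter> p)\<close>, so \<open>Phi a b p\<close>, if a face, lies in
  \<open>N_tilde X a b\<close>. In terms of the ring: a monomial with a negative exponent must have coefficient
  zero.\<close>
lemma T1_funs_Phi_zero:
  assumes "simplicial_complex X" "a \<inter> b = {}" "l \<in> T1_funs X a b" "\<forall>f. f \<notin> N X a b \<longrightarrow> l f = 0"
    and "p \<notin> X" "\<not> b \<subseteq> p"
  shows "l (Phi a b p) = 0"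
proof (cases "Phi a b p \<in> X")
  case True
  have "p \<subseteq> Phi a b p \<union> (b \<inter> p)" by (auto simp: Phi_def)
  with assms(1,5) have "Phi a b p \<union> (b \<inter> p) \<notin> X" by (auto simp: simplicial_complex_def)
  moreover have "b \<inter> p \<subset> b" using assms(6) by auto
  ultimately have "Phi a b p \<in> N_tilde X a b"
    using Phi_in_N[OF assms(1,2,5) True] by (auto simp: N_tilde_def)
  with assms(3) show ?thesis by (auto simp: T1_funs_def)
next
  case False
  with assms(4) show ?thesis by (simp add: N_def)
qed

lemma T1_funs_Phi_eq:
  assumes "simplicial_complex X" "a \<inter> b = {}" "l \<in> T1_funs X a b"
    and "p \<notin> X" "q \<notin> X" "Phi a b p \<union> Phi a b q \<in> X"
  shows "l (Phi a b p) = l (Phi a b q)"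
proof -
  have "Phi a b p \<in> X" "Phi a b q \<in> X"
    using assms(1,6) by (auto simp: simplicial_complex_def)
  then have "Phi a b p \<in> N X a b" "Phi a b q \<in> N X a b"
    using Phi_in_N assms by blast+
  with assms(3,6) show ?thesis by (auto simp: T1_funs_def)
qed

text \<open>The sets \<open>a\<close> and \<open>b\<close> are the supports of the positive and the negative part of the sum of the two
  degrees. A vertex of \<open>a1 \<inter> b2\<close> belongs to \<open>a\<close> or not, depending on multiplicities; the inclusions
  for \<open>a\<close> leave this open and keep the hypotheses symmetric in the two factors.\<close>
locale cup_functions =
  fixes X :: "'v set set" and a1 b1 a2 b2 a b :: "'v set" and \<phi> \<psi> :: "'v set \<Rightarrow> complex"
  assumes X: "simplicial_complex X"
    and ab1: "a1 \<inter> b1 = {}" and ab2: "a2 \<inter> b2 = {}" and b12: "b1 \<inter> b2 = {}"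
    and b: "b = (b1 - a2) \<union> (b2 - a1)"
    and a: "(a1 - b2) \<union> (a2 - b1) \<subseteq> a" "a \<subseteq> a1 \<union> a2"
    and \<phi>: "\<phi> \<in> T1_funs X a1 b1" and \<phi>_zero: "\<forall>f. f \<notin> N X a1 b1 \<longrightarrow> \<phi> f = 0"
    and \<psi>: "\<psi> \<in> T1_funs X a2 b2" and \<psi>_zero: "\<forall>f. f \<notin> N X a2 b2 \<longrightarrow> \<psi> f = 0"
begin

lemma swap: "cup_functions X a2 b2 a1 b1 a b \<psi> \<phi>"
  using X ab1 ab2 b12 b a \<phi> \<phi>_zero \<psi> \<psi>_zero by unfold_locales auto

lemma ab: "a \<inter> b = {}"
  using ab1 ab2 a b by auto

text \<open>This is the exponent bookkeeping behind evaluating \<open>\<psi>\<close> on a monomial produced by \<open>\<phi>\<close>.\<close>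
lemma Phi2_Phi1: "Phi a2 b2 (Phi a1 b1 p) = Phi a2 b2 (Phi a b p)"
  using ab1 ab2 b12 b a by (auto simp: Phi_def)

lemma subset_closed: "f \<in> X \<Longrightarrow> g \<subseteq> f \<Longrightarrow> g \<in> X"
  using X by (auto simp: simplicial_complex_def)

text \<open>Suppose \<open>\<psi>\<close> does not vanish at \<open>F2 = Phi a2 b2 F\<close>. The set \<open>F2 \<union> b1 \<union> (b2 \<inter> p)\<close> contains \<open>p\<close>, and
  \<open>b2 \<inter> p\<close> is a proper subset of \<open>b2\<close>; if \<open>F2 \<union> b1\<close> were a face, it would lie in \<open>N_tilde X a2 b2\<close>
  and force \<open>\<psi>\<close> to vanish at \<open>F2\<close>. So \<open>F2 \<union> b1\<close> is a nonface, with the same image under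
  \<open>Phi a1 b1\<close> as \<open>F\<close>. It can be compared with \<open>p\<close>, because \<open>F2 \<union> b'\<close> is a face for every proper
  subset \<open>b'\<close> of \<open>b2\<close>.\<close>
lemma mixed_product:
  assumes p: "p \<notin> X" and F: "a \<subseteq> F" "F \<inter> b = {}" "Phi a b p \<subseteq> F" and bp: "\<not> b2 - a1 \<subseteq> p"
  shows "\<phi> (Phi a1 b1 p) * \<psi> (Phi a2 b2 F) = \<phi> (Phi a1 b1 F) * \<psi> (Phi a2 b2 F)"
proof (cases "\<psi> (Phi a2 b2 F) = 0")
  case False
  let ?F2 = "Phi a2 b2 F" and ?p = "Phi a2 b2 F \<union> b1"
  have N: "?F2 \<in> N X a2 b2" and small: "\<And>b'. b' \<subset> b2 \<Longrightarrow> ?F2 \<union> b' \<in> X"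
    using False \<psi> \<psi>_zero by (auto simp: T1_funs_def N_tilde_def)
  have p': "?p \<notin> X"
  proof
    assume pX: "?p \<in> X"
    have "p \<subseteq> ?p \<union> (b2 \<inter> p)" using F(3) by (auto simp: Phi_def b)
    then have "?p \<union> (b2 \<inter> p) \<notin> X" using p subset_closed by blast
    moreover have "b2 \<inter> p \<subset> b2" using bp by auto
    moreover have "?p \<in> N X a2 b2"
    proof -
      have "?F2 \<union> b2 \<subseteq> ?p \<union> b2" by auto
      then show ?thesis using N pX b12 subset_closed by (auto simp: N_def)
    qed
    ultimately have "?p \<in> N_tilde X a2 b2" by (auto simp: N_tilde_def)
    moreover have "?F2 \<union> ?p \<in> X" using pX by (simp add: Un_absorb1)
    ultimately have "\<psi> ?F2 = 0"
      using \<psi> N \<open>?p \<in> N X a2 b2\<close> unfolding T1_funs_def by force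
    with False show False ..
  qed
  have eq: "Phi a1 b1 ?p = Phi a1 b1 F"
    using F a b ab1 ab2 b12 by (auto simp: Phi_def)
  have "?F2 \<union> (b2 \<inter> (a1 \<union> p)) \<in> X"
    using bp by (intro small) auto
  moreover have "Phi a1 b1 p \<union> Phi a1 b1 ?p \<subseteq> ?F2 \<union> (b2 \<inter> (a1 \<union> p))"
    unfolding eq using F a b ab1 ab2 b12 by (auto simp: Phi_def)
  ultimately have "Phi a1 b1 p \<union> Phi a1 b1 ?p \<in> X" using subset_closed by blast
  from T1_funs_Phi_eq[OF X ab1 \<phi> p p' this] show ?thesis by (simp add: eq)
qed simp

text \<open>If \<open>\<phi>\<close> distinguishes \<open>p\<close> from \<open>q\<close>, one of them contains \<open>b1\<close>, so that \<open>a2 \<subseteq> F\<close> and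
  \<open>Phi a2 b2 F' \<subseteq> F'\<close> is a face; moreover the two images under \<open>Phi a1 b1\<close> do not lie in a common face,
  so \<open>F \<union> b2\<close>, which contains both, is a nonface. Thus both arguments of \<open>\<psi>\<close> lie in \<open>N X a2 b2\<close>, and one contains the
  other.\<close>
lemma link_independence:
  assumes p: "p \<notin> X" "q \<notin> X" and F: "a \<subseteq> F" "F' \<inter> b = {}" "Phi a b p \<union> Phi a b q \<subseteq> F"
    "F \<subseteq> F'" "F' \<in> X"
    and neq: "\<phi> (Phi a1 b1 p) \<noteq> \<phi> (Phi a1 b1 q)"
  shows "\<psi> (Phi a2 b2 F) = \<psi> (Phi a2 b2 F')"
proof -
  have "b1 \<subseteq> p \<or> b1 \<subseteq> q"
    using neq T1_funs_Phi_zero[OF X ab1 \<phi> \<phi>_zero] p by metis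
  then have a2: "a2 \<subseteq> F"
  proof
    assume "b1 \<subseteq> p"
    then show ?thesis using F(1,3) a(1) b b12 ab2 unfolding Phi_def by blast
  next
    assume "b1 \<subseteq> q"
    then show ?thesis using F(1,3) a(1) b b12 ab2 unfolding Phi_def by blast
  qed
  then have sub: "Phi a2 b2 F \<subseteq> Phi a2 b2 F'" "Phi a2 b2 F' \<subseteq> F'"
    using F(4) by (auto simp: Phi_def)
  have "Phi a1 b1 p \<union> Phi a1 b1 q \<notin> X"
    using neq T1_funs_Phi_eq[OF X ab1 \<phi> p] by blast
  moreover have "Phi a1 b1 p \<union> Phi a1 b1 q \<subseteq> Phi a2 b2 F \<union> b2"
    using F(1,3) a(1) b by (auto simp: Phi_def)
  ultimately have "Phi a2 b2 F \<union> b2 \<notin> X" using subset_closed by blast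
  moreover from this have "Phi a2 b2 F' \<union> b2 \<notin> X"
    using sub(1) subset_closed[of "Phi a2 b2 F' \<union> b2"] by blast
  moreover have "Phi a2 b2 F' \<in> X" using sub(2) F(5) subset_closed by blast
  moreover from this have "Phi a2 b2 F \<in> X" using sub(1) subset_closed by blast
  ultimately have "Phi a2 b2 F \<in> N X a2 b2" "Phi a2 b2 F' \<in> N X a2 b2"
    "Phi a2 b2 F \<union> Phi a2 b2 F' \<in> X"
    using ab2 sub(1) by (auto simp: N_def Phi_def Un_absorb1)
  with \<psi> show ?thesis by (auto simp: T1_funs_def)
qed

text \<open>The contribution of a nonface \<open>p\<close> to the value of the cup product on a relation \<open>R\<^sub>p\<^sub>,\<^sub>q\<close> with
  \<open>Phi a b (p \<union> q) = F\<close>.\<close>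
definition cup_coeff :: "'v set \<Rightarrow> 'v set \<Rightarrow> complex" where
  "cup_coeff F p = \<phi> (Phi a1 b1 p) * \<psi> (Phi a2 b2 F) + \<psi> (Phi a2 b2 p) * \<phi> (Phi a1 b1 F)"

text \<open>If \<open>b\<close> is not contained in \<open>p\<close>, then \<open>p\<close> misses a vertex of \<open>b2 - a1\<close> or of \<open>b1 - a2\<close>. This kills
  one summand, and \<open>mixed_product\<close> evaluates the other; both cases give the same value.\<close>
lemma cup_coeff_not_subset:
  assumes p: "p \<notin> X" and F: "a \<subseteq> F" "F \<inter> b = {}" "Phi a b p \<subseteq> F" and bp: "\<not> b \<subseteq> p"
  shows "cup_coeff F p = \<phi> (Phi a1 b1 F) * \<psi> (Phi a2 b2 F)"
proof -
  interpret sw: cup_functions X a2 b2 a1 b1 a b \<psi> \<phi> by (rule swap)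
  have "\<not> b2 - a1 \<subseteq> p \<or> \<not> b1 - a2 \<subseteq> p" using bp b by auto
  then show ?thesis
  proof
    assume b2: "\<not> b2 - a1 \<subseteq> p"
    then have "\<not> b2 \<subseteq> p" by auto
    then have "\<psi> (Phi a2 b2 p) = 0" using T1_funs_Phi_zero[OF X ab2 \<psi> \<psi>_zero p] by simp
    with mixed_product[OF p F b2] show ?thesis by (simp add: cup_coeff_def)
  next
    assume b1: "\<not> b1 - a2 \<subseteq> p"
    then have "\<not> b1 \<subseteq> p" by auto
    then have "\<phi> (Phi a1 b1 p) = 0" using T1_funs_Phi_zero[OF X ab1 \<phi> \<phi>_zero p] by simp
    with sw.mixed_product[OF p F b1] show ?thesis by (simp add: cup_coeff_def mult.commute)
  qed
qed

lemma cup_coeff_diff: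
  assumes p: "p \<notin> X" "q \<notin> X" and F: "a \<subseteq> F" "F' \<inter> b = {}" "Phi a b p \<union> Phi a b q \<subseteq> F"
    "F \<subseteq> F'" "F' \<in> X"
  shows "cup_coeff F p - cup_coeff F q = cup_coeff F' p - cup_coeff F' q"
proof -
  interpret sw: cup_functions X a2 b2 a1 b1 a b \<psi> \<phi> by (rule swap)
  have "(\<phi> (Phi a1 b1 p) - \<phi> (Phi a1 b1 q)) * (\<psi> (Phi a2 b2 F) - \<psi> (Phi a2 b2 F')) = 0"
    "(\<psi> (Phi a2 b2 p) - \<psi> (Phi a2 b2 q)) * (\<phi> (Phi a1 b1 F) - \<phi> (Phi a1 b1 F')) = 0"
    using link_independence[OF p F] sw.link_independence[OF p F] by auto
  then show ?thesis
    unfolding cup_coeff_def by algebra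
qed

end

text \<open>The additional datum is the choice of the sets \<open>d f\<close>.\<close>
locale cup_functions_choice = cup_functions +
  fixes d :: "'a set \<Rightarrow> 'a set"
  assumes d: "\<forall>f\<in>N X a b. maximal_removable X b f (d f)"
begin

text \<open>A section of \<open>Phi a b\<close> over \<open>N X a b\<close> with values in the nonfaces.\<close>
definition section_of :: "'a set \<Rightarrow> 'a set" where
  "section_of f = f \<union> (b - d f)"

definition cup_fun :: "'a set \<Rightarrow> 'a set \<Rightarrow> complex" where
  "cup_fun f g = cup_coeff (f \<union> g) (section_of f) - cup_coeff (f \<union> g) (section_of g)"

lemma section_of_notin: "f \<in> N X a b \<Longrightarrow> section_of f \<notin> X"
  using d by (auto simp: maximal_removable_def section_of_def)

lemma Phi_section_of: "f \<in> N X a b \<Longrightarrow> Phi a b (section_of f) = f"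
  using ab by (auto simp: N_def section_of_def Phi_def)

text \<open>By maximality \<open>d f\<close> is nonempty as soon as some nonempty subset of \<open>b\<close> can be removed.\<close>
lemma section_of_N_tilde:
  assumes "f \<in> N_tilde X a b"
  shows "\<not> b \<subseteq> section_of f"
proof -
  have f: "f \<in> N X a b" using assms by (simp add: N_tilde_def)
  obtain b' where b': "b' \<subset> b" "f \<union> b' \<notin> X" using assms by (auto simp: N_tilde_def)
  have m: "maximal_removable X b f (d f)" using d f by blast
  have "d f \<noteq> {}"
  proof
    assume "d f = {}"
    moreover have "b - (b - b') = b'" "b - b' \<noteq> {}" using b'(1) by auto
    ultimately show False
      using m b'(2) unfolding maximal_removable_def by (metis Diff_subset empty_subsetI psubsetI)
  qed
  moreover have "d f \<subseteq> b" using m by (simp add: maximal_removable_def)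
  moreover have "f \<inter> b = {}" using f by (simp add: N_def)
  ultimately show ?thesis unfolding section_of_def by blast
qed

lemma Phi1_section_of:
  assumes "f \<in> N X a b"
  shows "Phi a1 b1 (section_of f) = (f - b1) \<union> (b2 - d f)"
proof -
  have "d f \<subseteq> b" using d assms by (auto simp: maximal_removable_def)
  moreover have "a \<subseteq> f" "f \<inter> b = {}" using assms by (auto simp: N_def)
  ultimately show ?thesis
    unfolding section_of_def using a b ab1 ab2 b12 by (auto simp: Phi_def)
qed

lemma cup_fun_eq:
  assumes "f \<in> N X a b" "g \<in> N X a b"
  shows "cup_fun f g =
    (\<phi> ((f - b1) \<union> (b2 - d f)) - \<phi> ((g - b1) \<union> (b2 - d g))) * \<psi> ((f \<union> g \<union> a2) - b2)
    + (\<psi> ((f - b2) \<union> (b1 - d f)) - \<psi> ((g - b2) \<union> (b1 - d g))) * \<phi> ((f \<union> g \<union> a1) - b1)"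
proof -
  interpret sw: cup_functions_choice X a2 b2 a1 b1 a b \<psi> \<phi> d
    using swap d by (simp add: cup_functions_choice_def cup_functions_choice_axioms_def)
  have "sw.section_of = section_of" by (simp add: fun_eq_iff section_of_def sw.section_of_def)
  then show ?thesis
    using Phi1_section_of[OF assms(1)] Phi1_section_of[OF assms(2)]
      sw.Phi1_section_of[OF assms(1)] sw.Phi1_section_of[OF assms(2)]
    by (simp add: cup_fun_def cup_coeff_def Phi_def[of _ _ "f \<union> g"] algebra_simps)
qed

text \<open>Over \<open>N_tilde X a b\<close> the coefficient at the section is the same for all \<open>f \<subseteq> F\<close>, so it cancels in
  differences.\<close>
lemma cup_coeff_section_of:
  assumes f: "f \<in> N_tilde X a b" and F: "f \<subseteq> F" "F \<inter> b = {}"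
  shows "cup_coeff F (section_of f) = \<phi> (Phi a1 b1 F) * \<psi> (Phi a2 b2 F)"
proof -
  have fN: "f \<in> N X a b" using f by (simp add: N_tilde_def)
  show ?thesis
    using fN F
    by (intro cup_coeff_not_subset section_of_notin section_of_N_tilde f)
      (auto simp: Phi_section_of N_def)
qed

lemma cup_fun_enlarge:
  assumes "f \<in> N X a b" "g \<in> N X a b" "f \<union> g \<subseteq> F" "F \<inter> b = {}" "F \<in> X"
  shows "cup_fun f g = cup_coeff F (section_of f) - cup_coeff F (section_of g)"
  unfolding cup_fun_def using assms
  by (intro cup_coeff_diff section_of_notin) (auto simp: Phi_section_of N_def)

text \<open>In the cocycle condition all three terms can be evaluated at the common face \<open>f \<union> g \<union> h\<close>, where
  they are differences of coefficients and telescope.\<close>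
theorem cup_fun_in_T2_funs: "cup_fun \<in> T2_funs X a b"
  unfolding T2_funs_def mem_Collect_eq
proof (intro conjI)
  show "\<forall>(f, g)\<in>N2 X a b. cup_fun f g = - cup_fun g f"
    by (auto simp: cup_fun_def Un_commute)
  show "\<forall>(f, g)\<in>N2 X a b. f \<in> N_tilde X a b \<longrightarrow> g \<in> N_tilde X a b \<longrightarrow> cup_fun f g = 0"
  proof clarify
    fix f g assume "(f, g) \<in> N2 X a b" and fg: "f \<in> N_tilde X a b" "g \<in> N_tilde X a b"
    then have "(f \<union> g) \<inter> b = {}" by (auto simp: N2_def N_def)
    with cup_coeff_section_of[OF fg(1), of "f \<union> g"] cup_coeff_section_of[OF fg(2), of "f \<union> g"]
    show "cup_fun f g = 0" by (simp add: cup_fun_def)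
  qed
  show "\<forall>f\<in>N X a b. \<forall>g\<in>N X a b. \<forall>h\<in>N X a b. f \<union> g \<union> h \<in> X \<longrightarrow>
    cup_fun f g - cup_fun f h + cup_fun g h = 0"
  proof (intro ballI impI)
    fix f g h assume fgh: "f \<in> N X a b" "g \<in> N X a b" "h \<in> N X a b" "f \<union> g \<union> h \<in> X"
    then have "(f \<union> g \<union> h) \<inter> b = {}" by (auto simp: N_def)
    with fgh show "cup_fun f g - cup_fun f h + cup_fun g h = 0"
      by (simp add: cup_fun_enlarge[where F = "f \<union> g \<union> h"] Un_assoc le_supI1 le_supI2)
  qed
qed

text \<open>The coefficients of the homomorphism on the free module that turns the cup product, computed with
  monomial lifts, into the representative \<open>cup_fun\<close>.\<close>
definition correction :: "'a set \<Rightarrow> complex" where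
  "correction p = (if Phi a b p \<in> X
     then cup_coeff (Phi a b p) p - cup_coeff (Phi a b p) (section_of (Phi a b p)) else 0)"

text \<open>Both \<open>p\<close> and the section over \<open>Phi a b p\<close> fail to contain \<open>b\<close>, and their coefficients agree by
  \<open>cup_coeff_not_subset\<close>.\<close>
lemma correction_not_subset:
  assumes p: "p \<notin> X" and bp: "\<not> b \<subseteq> p"
  shows "correction p = 0"
proof (cases "Phi a b p \<in> X")
  case True
  let ?f = "Phi a b p"
  have N: "?f \<in> N X a b" by (rule Phi_in_N[OF X ab p True])
  have "p \<subseteq> ?f \<union> (b \<inter> p)" by (auto simp: Phi_def)
  then have "?f \<union> (b \<inter> p) \<notin> X" using p subset_closed by blast
  moreover have "b \<inter> p \<subset> b" using bp by auto
  ultimately have "?f \<in> N_tilde X a b" using N by (auto simp: N_tilde_def)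
  with N have "cup_coeff ?f (section_of ?f) = \<phi> (Phi a1 b1 ?f) * \<psi> (Phi a2 b2 ?f)"
    by (intro cup_coeff_section_of) (auto simp: N_def)
  moreover have "cup_coeff ?f p = \<phi> (Phi a1 b1 ?f) * \<psi> (Phi a2 b2 ?f)"
    using N by (intro cup_coeff_not_subset p bp) (auto simp: N_def)
  ultimately show ?thesis by (simp add: correction_def)
qed (simp add: correction_def)

text \<open>The corrections are defined at the faces \<open>Phi a b p\<close> and \<open>Phi a b q\<close>; by \<open>cup_coeff_diff\<close> they may be
  evaluated at the larger face \<open>Phi a b (p \<union> q)\<close>.\<close>
lemma cup_coeff_decomposition:
  assumes p: "p \<notin> X" "q \<notin> X" and F: "Phi a b (p \<union> q) \<in> X"
  shows "cup_coeff (Phi a b (p \<union> q)) p - cup_coeff (Phi a b (p \<union> q)) q =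
    cup_fun (Phi a b p) (Phi a b q) + (correction p - correction q)"
proof -
  let ?F = "Phi a b (p \<union> q)" and ?f = "Phi a b p" and ?g = "Phi a b q"
  have FU: "?F = ?f \<union> ?g" by (auto simp: Phi_def)
  have X': "?f \<in> X" "?g \<in> X" using F FU subset_closed by auto
  have N: "?f \<in> N X a b" "?g \<in> N X a b" using Phi_in_N[OF X ab] p X' by auto
  have Fb: "?F \<inter> b = {}" by (auto simp: Phi_def)
  have a': "a \<subseteq> ?f" "a \<subseteq> ?g" using N by (auto simp: N_def)
  have *: "correction r = cup_coeff ?F r - cup_coeff ?F (section_of (Phi a b r))"
    if "r \<notin> X" "Phi a b r \<in> X" "Phi a b r \<in> N X a b" "Phi a b r \<subseteq> ?F" for r
    using that Fb F
    by (simp add: correction_def)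
      (intro cup_coeff_diff section_of_notin; auto simp: Phi_section_of N_def)
  have "correction p = cup_coeff ?F p - cup_coeff ?F (section_of ?f)"
    "correction q = cup_coeff ?F q - cup_coeff ?F (section_of ?g)"
    using * p X' N FU by auto
  moreover have "cup_fun ?f ?g = cup_coeff ?F (section_of ?f) - cup_coeff ?F (section_of ?g)"
    by (simp add: cup_fun_def FU)
  ultimately show ?thesis by simp
qed

end

section \<open>The cup product in multidegrees\<close>

lemma pairing_Rel0:
  assumes "r \<in> Rel0 X"
  shows "pairing X r v \<in> SR_ideal X"
proof -
  let ?K = "{r. pairing X r v \<in> SR_ideal X}"
  note I = SR_ideal_subspace[of X]
  have "Rel0 X \<subseteq> ?K"
    unfolding Rel0_def
  proof (rule pvec.span_minimal)
    show "pvec.subspace ?K"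
      by (rule pvec.subspaceI)
        (auto simp: pairing_linear ideal.subspace_add[OF I] ideal.subspace_scale[OF I],
          simp add: pairing_def ideal.subspace_0[OF I])
    have "pairing X (vscale (gen_map X f) e - vscale (gen_map X e) f) v \<in> SR_ideal X" for e f
      unfolding pairing_linear using gen_map_in_SR_ideal[of X]
      by (auto intro!: ideal.subspace_diff[OF I] ideal.subspace_scale[OF I]
          simp: mult.commute[of "gen_map X _"])
    then show "{vscale (gen_map X f) e - vscale (gen_map X e) f |e f.
        e \<in> free_mod X \<and> f \<in> free_mod X} \<subseteq> ?K" by auto
  qed
  with assms show ?thesis by auto
qed

text \<open>By the definition of \<open>R\<^sub>0\<close>, pairing with any vector maps it into \<open>I\<close>; so the restriction of a
  homomorphism on the free module descends to \<open>R/R\<^sub>0\<close> and can be added to \<open>h\<close>.\<close>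
lemma T2_class_translate:
  assumes "h \<in> Hom_Rel X"
  obtains h' where "h' \<in> T2_class X h"
    "\<And>r. r \<in> Rel X \<Longrightarrow> h' (r +o Rel0 X) = h (r +o Rel0 X) + (pairing X r v +o SR_ideal X)"
proof -
  let ?I = "SR_ideal X"
  note I = SR_ideal_subspace[of X]
  have "(\<lambda>r\<in>Rel X. h (r +o Rel0 X)) \<in> hom_quot vscale (Rel X) ?I"
    using assms by (simp add: Hom_Rel_def)
  from hom_quot_lift[OF module_vscale Rel_subspace I this]
  obtain H where H: "linear_mod vscale (Rel X) ?I H"
    and hH: "\<And>r. r \<in> Rel X \<Longrightarrow> (\<lambda>r\<in>Rel X. h (r +o Rel0 X)) r = H r +o ?I"
    by blast
  have lin: "linear_mod vscale (Rel X) ?I (\<lambda>r. H r + pairing X r v)"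
    using H by (simp add: linear_mod_def pairing_linear algebra_simps)
  have "H r + pairing X r v \<in> ?I" if r: "r \<in> Rel0 X" for r
  proof -
    have "r +o Rel0 X = 0 +o Rel0 X"
      using r by (simp add: pvec.coset_zero_iff[OF Rel0_subspace])
    moreover have "r \<in> Rel X" "0 \<in> Rel X"
      using r Rel0_subset_Rel pvec.subspace_0[OF Rel_subspace] by auto
    ultimately have "H r +o ?I = H 0 +o ?I"
      using hH[of r] hH[of 0] by simp
    moreover have "H 0 \<in> ?I"
      using linear_mod_zero[OF module_vscale Rel_subspace I H] .
    ultimately have "H r \<in> ?I" by (metis ideal.coset_zero_iff[OF I])
    then show ?thesis by (intro ideal.subspace_add[OF I] pairing_Rel0 r)
  qed
  from Hom_Rel_exists[OF lin this] obtain h' where h': "h' \<in> Hom_Rel X"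
    "\<And>r. r \<in> Rel X \<Longrightarrow> h' (r +o Rel0 X) = (H r + pairing X r v) +o ?I" by blast
  then have "h' (r +o Rel0 X) = h (r +o Rel0 X) + (pairing X r v +o ?I)" if "r \<in> Rel X" for r
    using hH[OF that] that by (simp add: ideal.coset_add[OF I])
  with h'(1) that show ?thesis unfolding T2_class_iff by blast
qed

lemma cup_homogeneous:
  assumes "\<xi> \<in> T1 X c" "\<eta> \<in> T1 X e"
  obtains h where "h \<in> Hom_Rel_degree X (c + e)" "cup X \<xi> \<eta> = T2_class X h"
proof -
  obtain \<phi> \<psi> where \<phi>: "\<phi> \<in> Hom_I_degree X c" "\<xi> = T1_class X \<phi>"
    and \<psi>: "\<psi> \<in> Hom_I_degree X e" "\<eta> = T1_class X \<psi>"
    using assms by (auto simp: T1_def)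
  have mem: "\<phi> \<in> Hom_I X" "\<psi> \<in> Hom_I X"
    using \<phi>(1) \<psi>(1) by (auto simp: Hom_I_degree_def)
  obtain u where u: "u \<in> lifts X \<phi>" "\<And>p. u p \<in> range (\<lambda>z. mon z (indicator p + c))"
    using homogeneous_lifts[OF \<phi>(1)] by blast
  obtain w where w: "w \<in> lifts X \<psi>" "\<And>p. w p \<in> range (\<lambda>z. mon z (indicator p + e))"
    using homogeneous_lifts[OF \<psi>(1)] by blast
  obtain h where h: "cup_rep X \<phi> \<psi> u w h" using cup_rep_exists[OF mem u(1) w(1)] .
  have "h \<in> Hom_Rel_degree X (c + e)"
    using cup_rep_degree[OF \<phi>(1) \<psi>(1) h u(2) w(2)] .
  moreover have "cup X \<xi> \<eta> = T2_class X h"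
    unfolding \<phi>(2) \<psi>(2)
    using cup_eq_T2_class[OF mem mem_T1_class_self[OF mem(1)] mem_T1_class_self[OF mem(2)] h] .
  ultimately show ?thesis by (rule that)
qed

lemma degree_nonneg_iff:
  assumes "\<forall>v. b v \<in> {0, 1 :: nat}" "supp a \<inter> supp b = {}"
  shows "(\<forall>v. 0 \<le> (indicator p + deg a b) v) \<longleftrightarrow> supp b \<subseteq> p"
proof -
  have "0 \<le> (indicator p + deg a b) v \<longleftrightarrow> (b v \<noteq> 0 \<longrightarrow> v \<in> p)" for v
    using assms(1)[rule_format, of v] assms(2)
    by (auto simp: deg_def indicator_def supp_def disjoint_iff)
  then show ?thesis by (auto simp: supp_def)
qed

lemma degree_support:
  assumes "\<forall>v. b v \<in> {0, 1 :: nat}" "supp a \<inter> supp b = {}" "supp b \<subseteq> p"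
  shows "{v. 0 < (indicator p + deg a b) v} = Phi (supp a) (supp b) p"
proof -
  have "0 < (indicator p + deg a b) v \<longleftrightarrow> b v = 0 \<and> (a v \<noteq> 0 \<or> v \<in> p)" for v
    using assms(1)[rule_format, of v] assms(2,3)
    by (auto simp: deg_def indicator_def supp_def disjoint_iff subset_iff)
  then show ?thesis by (auto simp: supp_def Phi_def)
qed

text \<open>A homomorphism whose values on the generators are the monomials given by a function \<open>l\<close> that
  vanishes outside \<open>N\<close>; with this extension by zero the generators outside \<open>M\<close> need no separate
  case.\<close>
locale represented_hom =
  fixes X :: "'v::finite set set" and a b :: "'v \<Rightarrow> nat" and l :: "'v set \<Rightarrow> complex"
    and \<phi> :: "'v mpoly \<Rightarrow> 'v mpoly set"
  assumes X: "simplicial_complex X"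
    and b01: "\<forall>v. b v \<in> {0, 1}" and ab: "supp a \<inter> supp b = {}"
    and l: "l \<in> T1_funs X (supp a) (supp b)" and l_zero: "\<forall>f. f \<notin> N X (supp a) (supp b) \<longrightarrow> l f = 0"
    and \<phi>: "\<phi> \<in> Hom_I X"
    and \<phi>_xmon: "\<And>p. p \<notin> X \<Longrightarrow>
      \<phi> (xmon p) = mon (l (Phi (supp a) (supp b) p)) (indicator p + deg a b) +o SR_ideal X"
begin

abbreviation coeff :: "'v set \<Rightarrow> complex" where
  "coeff p \<equiv> l (Phi (supp a) (supp b) p)"

lemma coeff_nonneg:
  assumes "p \<notin> X" "coeff p \<noteq> 0"
  shows "\<forall>v. 0 \<le> (indicator p + deg a b) v"
  using T1_funs_Phi_zero[OF X ab l l_zero] assms degree_nonneg_iff[OF b01 ab] by blast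

text \<open>A monomial of \<open>I\<close> is a multiple of the generator given by its support, which determines the
  value.\<close>
lemma hom_monomial:
  assumes d: "z \<noteq> 0 \<Longrightarrow> \<forall>v. 0 \<le> d v" and I: "mon z d \<in> SR_ideal X"
  shows "\<phi> (mon z d) = mon (z * coeff {v. 0 < d v}) (d + deg a b) +o SR_ideal X"
proof -
  let ?I = "SR_ideal X" and ?s = "{v. 0 < d v}"
  note sub = SR_ideal_subspace[of X]
  obtain F where F: "linear_mod (*) ?I ?I F" "\<And>f. f \<in> ?I \<Longrightarrow> \<phi> f = F f +o ?I"
    using Hom_I_lift[OF \<phi>] by blast
  show ?thesis
  proof (cases "z = 0")
    case True
    then show ?thesis
      using F(2)[OF ideal.subspace_0[OF sub]] linear_mod_zero[OF ideal.module_axioms sub sub F(1)]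
      by (simp add: ideal.coset_zero_iff[OF sub])
  next
    case False
    with d have d0: "\<forall>v. 0 \<le> d v" by simp
    with I False have s: "?s \<notin> X" by (simp add: mon_in_SR_ideal_iff[OF X])
    have m: "\<forall>v. 0 \<le> (d - indicator ?s) v" using d0 by (auto simp: indicator_def)
    have ds: "d - indicator ?s + indicator ?s = d" by (simp add: fun_eq_iff)
    have dm: "mon z d = mon z (d - indicator ?s) * xmon ?s"
      using mon_mult[of z 1 "d - indicator ?s" "indicator ?s"] m unfolding xmon_def ds by simp
    have "d - indicator ?s + (indicator ?s + deg a b) = d + deg a b" by (simp add: fun_eq_iff)
    then have e: "mon z (d - indicator ?s) * mon (coeff ?s) (indicator ?s + deg a b) =
        mon (z * coeff ?s) (d + deg a b)"
      using mon_mult[of z "coeff ?s" "d - indicator ?s" "indicator ?s + deg a b"] m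
        coeff_nonneg[OF s] by simp
    have x: "xmon ?s \<in> ?I" by (rule xmon_in_SR_ideal[OF s])
    have "F (mon z (d - indicator ?s) * xmon ?s) - mon z (d - indicator ?s) * F (xmon ?s) \<in> ?I"
      using F(1) x unfolding linear_mod_def by blast
    moreover have "mon z (d - indicator ?s) *
        (F (xmon ?s) - mon (coeff ?s) (indicator ?s + deg a b)) \<in> ?I"
      using \<phi>_xmon[OF s] F(2)[OF x]
      by (intro ideal.subspace_scale[OF sub]) (simp add: ideal.coset_eq_iff[OF sub])
    ultimately have "F (mon z d) - mon (z * coeff ?s) (d + deg a b) \<in> ?I"
      using ideal.subspace_add[OF sub] unfolding dm e[symmetric] right_diff_distrib by fastforce
    then show ?thesis
      by (simp add: F(2)[OF I] ideal.coset_eq_iff[OF sub])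
  qed
qed

definition lift :: "'v pvec" where
  "lift p = mon (coeff p) (indicator p + deg a b)"

lemma lift_in_lifts: "lift \<in> lifts X \<phi>"
  by (auto simp: lifts_def lift_def \<phi>_xmon ideal.mem_coset_self[OF SR_ideal_subspace])

end


text \<open>The hypothesis on \<open>z\<close> guarantees that \<open>x\<^sup>q\<^sup>-\<^sup>p\<close> times the entry at \<open>p\<close> has coefficient \<open>z p\<close> in degree
  \<open>p \<union> q\<close> shifted by \<open>c\<close>: an entry of negative degree is zero, while the product of the monomials may
  have nonnegative degree.\<close>
lemma pairing_Rel_gen_mon:
  assumes p: "p \<notin> X" and q: "q \<notin> X"
    and z: "\<And>s. s \<notin> X \<Longrightarrow> z s \<noteq> 0 \<Longrightarrow> \<forall>v. 0 \<le> (indicator s + c) v"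
  shows "pairing X (Rel_gen p q) (\<lambda>s. mon (z s) (indicator s + c)) =
    mon (z p - z q) (indicator (p \<union> q) + c)"
proof -
  have *: "xmon (q - p) * mon (z p) (indicator p + c) = mon (z p) (indicator (p \<union> q) + c)"
    if "p \<notin> X" for p q
  proof -
    have "indicator (q - p) + (indicator p + c) = indicator (p \<union> q) + c"
      by (auto simp: fun_eq_iff indicator_def)
    then show ?thesis
      using mon_mult[of 1 "z p" "indicator (q - p)" "indicator p + c"] z[OF that]
      unfolding xmon_def \<open>indicator (q - p) + (indicator p + c) = indicator (p \<union> q) + c\<close> by simp
  qed
  show ?thesis
    using *[OF p, of q] *[OF q, of p]
    by (simp add: pairing_Rel_gen[OF p q] mon_diff Un_commute)
qed

lemma represents1E:
  assumes "represents1 X a b l \<xi>" "\<forall>f. f \<notin> N X (supp a) (supp b) \<longrightarrow> l f = 0"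
    and "simplicial_complex X" "\<forall>v. b v \<in> {0, 1}" "supp a \<inter> supp b = {}" "\<xi> \<subseteq> Hom_I X"
  obtains \<phi> where "\<phi> \<in> \<xi>" "represented_hom X a b l \<phi>"
proof -
  obtain \<phi> where \<phi>: "\<phi> \<in> \<xi>" "\<And>p. p \<notin> X \<Longrightarrow>
      \<phi> (xmon p) = (if p \<in> M X (supp a) (supp b)
        then mon (l (Phi (supp a) (supp b) p)) (indicator p + deg a b) else 0) +o SR_ideal X"
    using assms(1) unfolding represents1_def by blast
  have "l (Phi (supp a) (supp b) p) = 0" if "p \<notin> X" "p \<notin> M X (supp a) (supp b)" for p
    using that assms(2) by (auto simp: M_def N_def Phi_def)
  then have "\<phi> (xmon p) = mon (l (Phi (supp a) (supp b) p)) (indicator p + deg a b) +o SR_ideal X"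
    if "p \<notin> X" for p
    using \<phi>(2)[OF that] that by (simp split: if_splits)
  then have "represented_hom X a b l \<phi>"
    using assms \<phi>(1) by unfold_locales (auto simp: represents1_def)
  with \<phi>(1) that show ?thesis by blast
qed

text \<open>Entrywise: where one of the \<open>b\<^sub>i\<close> is \<open>1\<close>, the sum of the degrees is the other \<open>a\<close>-entry minus
  \<open>1\<close>.\<close>
lemma degree_sum_supports:
  assumes b01: "\<forall>v. b1 v \<in> {0, 1 :: nat}" "\<forall>v. b2 v \<in> {0, 1 :: nat}"
    and ab: "supp a1 \<inter> supp b1 = {}" "supp a2 \<inter> supp b2 = {}" "supp a \<inter> supp b = {}"
    and deg: "deg a1 b1 + deg a2 b2 = deg a b" and b12: "supp b1 \<inter> supp b2 = {}"
  shows "supp b = (supp b1 - supp a2) \<union> (supp b2 - supp a1)"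
    and "supp a = (supp a1 - supp b2) \<union> (supp a2 - supp b1) \<union> ({v. a1 v \<ge> 2} \<union> {v. a2 v \<ge> 2})"
    and "\<forall>v. b v \<in> {0, 1}"
proof -
  have v: "b1 v \<le> 1" "b2 v \<le> 1" "a1 v = 0 \<or> b1 v = 0" "a2 v = 0 \<or> b2 v = 0" "a v = 0 \<or> b v = 0"
    "b1 v = 0 \<or> b2 v = 0" "int (a1 v) - int (b1 v) + (int (a2 v) - int (b2 v)) = int (a v) - int (b v)"
    for v
    using b01 ab b12 fun_cong[OF deg, of v] by (auto simp: supp_def deg_def disjoint_iff le_Suc_eq)
  have "b v \<noteq> 0 \<longleftrightarrow> b1 v \<noteq> 0 \<and> a2 v = 0 \<or> b2 v \<noteq> 0 \<and> a1 v = 0" for v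
    using v[of v] by linarith
  then show "supp b = (supp b1 - supp a2) \<union> (supp b2 - supp a1)"
    by (auto simp: supp_def)
  have "a v \<noteq> 0 \<longleftrightarrow> a1 v \<noteq> 0 \<and> b2 v = 0 \<or> a2 v \<noteq> 0 \<and> b1 v = 0 \<or> a1 v \<ge> 2 \<or> a2 v \<ge> 2" for v
    using v[of v] by linarith
  then show "supp a = (supp a1 - supp b2) \<union> (supp a2 - supp b1)
      \<union> ({v. a1 v \<ge> 2} \<union> {v. a2 v \<ge> 2})"
    by (auto simp: supp_def)
  have "b v \<le> 1" for v
    using v[of v] by linarith
  then show "\<forall>v. b v \<in> {0, 1}" by (auto simp: le_Suc_eq)
qed

text \<open>The lifts pair \<open>R\<^sub>p\<^sub>,\<^sub>q\<close> to a multiple of one monomial, with coefficient the difference of the values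
  of \<open>\<phi>\<close>. If this is nonzero, the support of the monomial is \<open>Phi a1 b1 (p \<union> q)\<close>, and \<open>\<psi>\<close> multiplies it
  by its value at \<open>Phi a2 b2 F\<close>. The other summand is symmetric.\<close>
lemma cup_rep_Rel_gen:
  assumes \<phi>': "represented_hom X a1 b1 \<phi> \<phi>'" and \<psi>': "represented_hom X a2 b2 \<psi> \<psi>'"
    and cf: "cup_functions X (supp a1) (supp b1) (supp a2) (supp b2) (supp a) (supp b) \<phi> \<psi>"
    and deg: "deg a1 b1 + deg a2 b2 = deg a b"
    and h: "cup_rep X \<phi>' \<psi>' (represented_hom.lift a1 b1 \<phi>) (represented_hom.lift a2 b2 \<psi>) h"
    and p: "p \<notin> X" and q: "q \<notin> X"
  defines "F \<equiv> Phi (supp a) (supp b) (p \<union> q)"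
  defines "S \<equiv> cup_functions.cup_coeff (supp a1) (supp b1) (supp a2) (supp b2) \<phi> \<psi>"
  shows "h (Rel_gen p q +o Rel0 X) =
    mon (S F p - S F q) (indicator (p \<union> q) + deg a b) +o SR_ideal X"
proof -
  have half: "\<psi>' (pairing X (Rel_gen p q) (represented_hom.lift a1 b1 \<phi>)) =
      mon ((\<phi> (Phi (supp a1) (supp b1) p) - \<phi> (Phi (supp a1) (supp b1) q)) *
        \<psi> (Phi (supp a2) (supp b2) F)) (indicator (p \<union> q) + deg a b) +o SR_ideal X"
    if "represented_hom X a1 b1 \<phi> \<phi>'" "represented_hom X a2 b2 \<psi> \<psi>'"
      and cf: "cup_functions X (supp a1) (supp b1) (supp a2) (supp b2) (supp a) (supp b) \<phi> \<psi>"
      and deg: "deg a1 b1 + deg a2 b2 = deg a b"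
    for a1 b1 a2 b2 \<phi> \<psi> \<phi>' \<psi>'
  proof -
    interpret h1: represented_hom X a1 b1 \<phi> \<phi>' by fact
    interpret h2: represented_hom X a2 b2 \<psi> \<psi>' by fact
    interpret cf: cup_functions X "supp a1" "supp b1" "supp a2" "supp b2" "supp a" "supp b" \<phi> \<psi>
      by fact
    let ?z = "h1.coeff p - h1.coeff q" and ?d = "indicator (p \<union> q) + deg a1 b1"
    have pair: "pairing X (Rel_gen p q) h1.lift = mon ?z ?d"
      unfolding h1.lift_def[abs_def] by (rule pairing_Rel_gen_mon[OF p q h1.coeff_nonneg])
    have I: "mon ?z ?d \<in> SR_ideal X"
      using pairing_Rel_lift[OF h1.\<phi> h1.lift_in_lifts Rel_gen_in_Rel[OF p q]] by (simp only: pair)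
    have b1: "supp b1 \<subseteq> p \<union> q" if "?z \<noteq> 0"
      using that T1_funs_Phi_zero[OF h1.X h1.ab h1.l h1.l_zero] p q
      by (metis Un_commute diff_self sup.coboundedI1)
    have "\<psi>' (mon ?z ?d) = mon (?z * h2.coeff {v. 0 < ?d v}) (?d + deg a2 b2) +o SR_ideal X"
      using b1 degree_nonneg_iff[OF h1.b01 h1.ab, of "p \<union> q"] by (intro h2.hom_monomial I) simp
    also have "?z * h2.coeff {v. 0 < ?d v} = ?z * h2.coeff F"
    proof (cases "?z = 0")
      case False
      then have "{v. 0 < ?d v} = Phi (supp a1) (supp b1) (p \<union> q)"
        using degree_support[OF h1.b01 h1.ab b1] by blast
      then show ?thesis by (simp only: F_def cf.Phi2_Phi1)
    qed simp
    also have "?d + deg a2 b2 = indicator (p \<union> q) + deg a b"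
      by (simp add: add.assoc deg)
    finally show ?thesis by (simp only: pair)
  qed
  have "h (Rel_gen p q +o Rel0 X) =
      \<psi>' (pairing X (Rel_gen p q) (represented_hom.lift a1 b1 \<phi>)) +
      \<phi>' (pairing X (Rel_gen p q) (represented_hom.lift a2 b2 \<psi>))"
    using h Rel_gen_in_Rel[OF p q] by (simp add: cup_rep_def)
  moreover have "deg a2 b2 + deg a1 b1 = deg a b" using deg by (simp add: add.commute)
  ultimately have "h (Rel_gen p q +o Rel0 X) =
      (mon ((\<phi> (Phi (supp a1) (supp b1) p) - \<phi> (Phi (supp a1) (supp b1) q)) *
        \<psi> (Phi (supp a2) (supp b2) F)) (indicator (p \<union> q) + deg a b) +
      mon ((\<psi> (Phi (supp a2) (supp b2) p) - \<psi> (Phi (supp a2) (supp b2) q)) *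
        \<phi> (Phi (supp a1) (supp b1) F)) (indicator (p \<union> q) + deg a b)) +o SR_ideal X"
    using half[OF \<phi>' \<psi>' cf deg] half[OF \<psi>' \<phi>' cup_functions.swap[OF cf]]
    by (simp add: ideal.coset_add[OF SR_ideal_subspace])
  also have "\<dots> = mon (S F p - S F q) (indicator (p \<union> q) + deg a b) +o SR_ideal X"
    unfolding S_def cup_functions.cup_coeff_def[OF cf] mon_add[symmetric]
    by (simp add: algebra_simps)
  finally show ?thesis .
qed

lemma T2_funs_cong:
  assumes "l \<in> T2_funs X a b" "\<And>f g. f \<in> N X a b \<Longrightarrow> g \<in> N X a b \<Longrightarrow> l' f g = l f g"
  shows "l' \<in> T2_funs X a b"
proof -
  have N2: "l' f g = l f g \<and> l' g f = l g f" if "(f, g) \<in> N2 X a b" for f g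
    using that assms(2) by (auto simp: N2_def)
  show ?thesis
    unfolding T2_funs_def mem_Collect_eq
  proof (intro conjI)
    show "\<forall>(f, g)\<in>N2 X a b. l' f g = - l' g f"
      using N2 assms(1) by (auto simp: T2_funs_def)
    show "\<forall>(f, g)\<in>N2 X a b. f \<in> N_tilde X a b \<longrightarrow> g \<in> N_tilde X a b \<longrightarrow> l' f g = 0"
      using N2 assms(1) by (auto simp: T2_funs_def)
    show "\<forall>f\<in>N X a b. \<forall>g\<in>N X a b. \<forall>h\<in>N X a b.
        f \<union> g \<union> h \<in> X \<longrightarrow> l' f g - l' f h + l' g h = 0"
      using assms by (simp add: T2_funs_def)
  qed
qed

text \<open>The representative is the cup product computed with monomial lifts, corrected by the homomorphism
  on the free module with coefficients \<open>correction\<close>. That homomorphism has the right values on the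
  \<open>R\<^sub>p\<^sub>,\<^sub>q\<close> because its coefficient vanishes wherever the monomial in degree \<open>p\<close> does.\<close>
lemma cup_represented:
  assumes \<phi>': "represented_hom X a1 b1 \<phi> \<phi>'" and \<psi>': "represented_hom X a2 b2 \<psi> \<psi>'"
    and cfc: "cup_functions_choice X (supp a1) (supp b1) (supp a2) (supp b2) (supp a) (supp b) \<phi> \<psi> d"
    and deg: "deg a1 b1 + deg a2 b2 = deg a b" and b01: "\<forall>v. b v \<in> {0, 1}"
    and mem: "\<phi>0 \<in> Hom_I X" "\<psi>0 \<in> Hom_I X" "\<phi>' \<in> T1_class X \<phi>0" "\<psi>' \<in> T1_class X \<psi>0"
    and f_eq: "\<And>p q. p \<in> N X (supp a) (supp b) \<Longrightarrow> q \<in> N X (supp a) (supp b) \<Longrightarrow> f p q =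
      cup_functions_choice.cup_fun (supp a1) (supp b1) (supp a2) (supp b2) (supp b) \<phi> \<psi> d p q"
  shows "represents2 X a b f (cup X (T1_class X \<phi>0) (T1_class X \<psi>0))"
proof -
  interpret h1: represented_hom X a1 b1 \<phi> \<phi>' by fact
  interpret h2: represented_hom X a2 b2 \<psi> \<psi>' by fact
  interpret cup_functions_choice X "supp a1" "supp b1" "supp a2" "supp b2" "supp a" "supp b" \<phi> \<psi> d
    by fact
  let ?I = "SR_ideal X"
  note I = SR_ideal_subspace[of X]
  obtain h where h: "cup_rep X \<phi>' \<psi>' h1.lift h2.lift h"
    using cup_rep_exists[OF h1.\<phi> h2.\<phi> h1.lift_in_lifts h2.lift_in_lifts] .
  then have "h \<in> Hom_Rel X" by (simp add: cup_rep_def)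
  define v where "v = (\<lambda>p. mon (- correction p) (indicator p + deg a b))"
  obtain h' where h': "h' \<in> T2_class X h"
    and h'r: "\<And>r. r \<in> Rel X \<Longrightarrow> h' (r +o Rel0 X) = h (r +o Rel0 X) + (pairing X r v +o ?I)"
    using T2_class_translate[OF \<open>h \<in> Hom_Rel X\<close>] by blast
  have cup: "cup X (T1_class X \<phi>0) (T1_class X \<psi>0) = T2_class X h"
    using cup_eq_T2_class[OF mem h] .
  have "h' (Rel_gen p q +o Rel0 X) = (if (p \<union> q \<union> supp a) - supp b \<in> X
      then mon (f (Phi (supp a) (supp b) p) (Phi (supp a) (supp b) q))
        (indicator (p \<union> q) + deg a b) else 0) +o ?I"
    if p: "p \<notin> X" and q: "q \<notin> X" for p q
  proof -
    let ?F = "Phi (supp a) (supp b) (p \<union> q)" and ?D = "indicator (p \<union> q) + deg a b"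
    have "pairing X (Rel_gen p q) v = mon (- correction p - - correction q) ?D"
      unfolding v_def using p q correction_not_subset degree_nonneg_iff[OF b01 ab]
      by (intro pairing_Rel_gen_mon) (metis neg_equal_0_iff_equal)+
    then have eq: "h' (Rel_gen p q +o Rel0 X) =
        mon (cup_coeff ?F p - cup_coeff ?F q - (correction p - correction q)) ?D +o ?I"
      using cup_rep_Rel_gen[OF \<phi>' \<psi>' cup_functions_axioms deg h p q]
      by (simp add: h'r[OF Rel_gen_in_Rel[OF p q]] ideal.coset_add[OF I] diff_diff_eq2 add_diff_eq
          flip: mon_add)
    show ?thesis
    proof (cases "?F \<in> X")
      case True
      then have X': "Phi (supp a) (supp b) p \<in> X" "Phi (supp a) (supp b) q \<in> X"
        by (auto simp: Phi_def elim!: subset_closed)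
      show ?thesis
        using True cup_coeff_decomposition[OF p q True]
          f_eq[OF Phi_in_N[OF X ab p X'(1)] Phi_in_N[OF X ab q X'(2)]]
        unfolding eq by (simp add: Phi_def[of _ _ "p \<union> q"])
    next
      case False
      have "mon z ?D \<in> ?I" for z
      proof (cases "supp b \<subseteq> p \<union> q")
        case True
        then have "{v. 0 < ?D v} \<notin> X"
          using degree_support[OF b01 ab True] False by simp
        then show ?thesis by (rule mon_in_SR_ideal)
      next
        case False
        then have "mon z ?D = 0"
          by (intro mon_eq_0) (simp only: degree_nonneg_iff[OF b01 ab] not_False_eq_True)
        then show ?thesis by (simp add: ideal.subspace_0[OF I])
      qed
      then show ?thesis
        using False unfolding eq by (simp add: Phi_def[of _ _ "p \<union> q"] ideal.coset_zero_iff[OF I])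
    qed
  qed
  moreover have "f \<in> T2_funs X (supp a) (supp b)"
    by (rule T2_funs_cong[OF cup_fun_in_T2_funs f_eq])
  ultimately show ?thesis using h' cup unfolding represents2_def by blast
qed

theorem proposition19:
  fixes X :: "'v::finite set set"
    and a1 b1 a2 b2 a b :: "'v \<Rightarrow> nat"
  assumes "simplicial_complex X"
    and "\<forall>v. b1 v \<in> {0, 1}" and "\<forall>v. b2 v \<in> {0, 1}"
    and "supp a1 \<inter> supp b1 = {}" and "supp a2 \<inter> supp b2 = {}"
    and "deg a1 b1 + deg a2 b2 = deg a b"
    and "supp a \<inter> supp b = {}"
  shows "(\<forall>\<xi>\<in>T1 X (deg a1 b1). \<forall>\<eta>\<in>T1 X (deg a2 b2). cup X \<xi> \<eta> \<in> T2 X (deg a b))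
    \<and> (supp b1 \<inter> supp b2 \<noteq> {} \<longrightarrow>
        (\<forall>\<xi>\<in>T1 X (deg a1 b1). \<forall>\<eta>\<in>T1 X (deg a2 b2). cup X \<xi> \<eta> = T2_zero X))
    \<and> (supp b1 \<inter> supp b2 = {} \<longrightarrow>
        supp b = (supp b1 - supp a2) \<union> (supp b2 - supp a1) \<and>
        supp a = (supp a1 - supp b2) \<union> (supp a2 - supp b1)
                   \<union> ({v. a1 v \<ge> 2} \<union> {v. a2 v \<ge> 2}))
    \<and> (supp b1 \<inter> supp b2 = {} \<longrightarrow>
        (\<forall>d :: 'v set \<Rightarrow> 'v set. \<forall>\<phi> \<psi> :: 'v set \<Rightarrow> complex.
         \<forall>\<xi>\<in>T1 X (deg a1 b1). \<forall>\<eta>\<in>T1 X (deg a2 b2).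
          (\<forall>f\<in>N X (supp a) (supp b). maximal_removable X (supp b) f (d f)) \<longrightarrow>
          represents1 X a1 b1 \<phi> \<xi> \<longrightarrow> (\<forall>f. f \<notin> N X (supp a1) (supp b1) \<longrightarrow> \<phi> f = 0) \<longrightarrow>
          represents1 X a2 b2 \<psi> \<eta> \<longrightarrow> (\<forall>f. f \<notin> N X (supp a2) (supp b2) \<longrightarrow> \<psi> f = 0) \<longrightarrow>
          represents2 X a b
            (\<lambda>f g.
               (\<phi> ((f - supp b1) \<union> (supp b2 - d f)) - \<phi> ((g - supp b1) \<union> (supp b2 - d g)))
                 * \<psi> ((f \<union> g \<union> supp a2) - supp b2)
             + (\<psi> ((f - supp b2) \<union> (supp b1 - d f)) - \<psi> ((g - supp b2) \<union> (supp b1 - d g)))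
                 * \<phi> ((f \<union> g \<union> supp a1) - supp b1))
            (cup X \<xi> \<eta>)))"
proof (intro conjI impI ballI allI)
  note X = assms(1) and b01 = assms(2,3) and ab = assms(4,5,7) and deg = assms(6)
  {
    fix \<xi> \<eta> assume "\<xi> \<in> T1 X (deg a1 b1)" "\<eta> \<in> T1 X (deg a2 b2)"
    then obtain h where h: "h \<in> Hom_Rel_degree X (deg a b)" "cup X \<xi> \<eta> = T2_class X h"
      using cup_homogeneous deg by metis
    then show "cup X \<xi> \<eta> \<in> T2 X (deg a b)" by (auto simp: T2_def)
    assume "supp b1 \<inter> supp b2 \<noteq> {}"
    then obtain v where v: "v \<in> supp b1" "v \<in> supp b2" by auto
    then have "b1 v = 1" "b2 v = 1" "a1 v = 0" "a2 v = 0"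
      using assms(2,3)[rule_format, of v] ab by (auto simp: supp_def disjoint_iff)
    then have "deg a b v < - 1"
      using fun_cong[OF deg, of v] by (simp add: deg_def)
    then show "cup X \<xi> \<eta> = T2_zero X"
      using Hom_Rel_degree_trivial[OF X h(1)] h(2) by (simp add: T2_zero_def)
  }
  assume b12: "supp b1 \<inter> supp b2 = {}"
  note supports = degree_sum_supports[OF b01 ab deg b12]
  show "supp b = (supp b1 - supp a2) \<union> (supp b2 - supp a1)"
    "supp a = (supp a1 - supp b2) \<union> (supp a2 - supp b1) \<union> ({v. a1 v \<ge> 2} \<union> {v. a2 v \<ge> 2})"
    by (fact supports)+
  fix d :: "'v set \<Rightarrow> 'v set" and \<phi> \<psi> :: "'v set \<Rightarrow> complex" and \<xi> \<eta>
  assume \<xi>: "\<xi> \<in> T1 X (deg a1 b1)" and \<eta>: "\<eta> \<in> T1 X (deg a2 b2)"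
    and d: "\<forall>f\<in>N X (supp a) (supp b). maximal_removable X (supp b) f (d f)"
    and \<phi>: "represents1 X a1 b1 \<phi> \<xi>" "\<forall>f. f \<notin> N X (supp a1) (supp b1) \<longrightarrow> \<phi> f = 0"
    and \<psi>: "represents1 X a2 b2 \<psi> \<eta>" "\<forall>f. f \<notin> N X (supp a2) (supp b2) \<longrightarrow> \<psi> f = 0"
  obtain \<phi>0 \<psi>0 where \<phi>0: "\<phi>0 \<in> Hom_I X" "\<xi> = T1_class X \<phi>0"
    and \<psi>0: "\<psi>0 \<in> Hom_I X" "\<eta> = T1_class X \<psi>0"
    using \<xi> \<eta> by (auto simp: T1_def Hom_I_degree_def)
  obtain \<phi>' where \<phi>': "\<phi>' \<in> \<xi>" "represented_hom X a1 b1 \<phi> \<phi>'"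
    using represents1E[OF \<phi> X b01(1) ab(1)] by (auto simp: \<phi>0(2) T1_class_def)
  obtain \<psi>' where \<psi>': "\<psi>' \<in> \<eta>" "represented_hom X a2 b2 \<psi> \<psi>'"
    using represents1E[OF \<psi> X b01(2) ab(2)] by (auto simp: \<psi>0(2) T1_class_def)
  interpret cup_functions_choice X "supp a1" "supp b1" "supp a2" "supp b2" "supp a" "supp b" \<phi> \<psi> d
  proof unfold_locales
    show "\<phi> \<in> T1_funs X (supp a1) (supp b1)" "\<psi> \<in> T1_funs X (supp a2) (supp b2)"
      using \<phi>(1) \<psi>(1) by (auto simp: represents1_def)
    show "(supp a1 - supp b2) \<union> (supp a2 - supp b1) \<subseteq> supp a"
      unfolding supports(2) by blast
    show "supp a \<subseteq> supp a1 \<union> supp a2"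
      unfolding supports(2) by (auto simp: supp_def)
  qed (fact X ab b12 supports(1) \<phi>(2) \<psi>(2) d)+
  show "represents2 X a b
      (\<lambda>f g.
         (\<phi> ((f - supp b1) \<union> (supp b2 - d f)) - \<phi> ((g - supp b1) \<union> (supp b2 - d g)))
           * \<psi> ((f \<union> g \<union> supp a2) - supp b2)
       + (\<psi> ((f - supp b2) \<union> (supp b1 - d f)) - \<psi> ((g - supp b2) \<union> (supp b1 - d g)))
           * \<phi> ((f \<union> g \<union> supp a1) - supp b1))
      (cup X \<xi> \<eta>)"
    unfolding \<phi>0(2) \<psi>0(2)
    by (rule cup_represented[OF \<phi>'(2) \<psi>'(2) cup_functions_choice_axioms deg supports(3)
          \<phi>0(1) \<psi>0(1) \<phi>'(1)[unfolded \<phi>0(2)] \<psi>'(1)[unfolded \<psi>0(2)]])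
      (simp add: cup_fun_eq)
qed

end
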